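(* Let $\Omega\subset\mathbb{R}$ be a bounded interval. Then there is a constant $C(\Omega)$, depending only on the length $|\Omega|$ of $\Omega$, such that the following holds. Let $x_1,\dots,x_N\in\mathbb{R}$ be pairwise distinct, let $\mu_N=\frac1N\sum_{i=1}^N\delta_{x_i}$, and for $\varepsilon>0$ let $$\sigma_N=\operatorname*{argmin}_{\rho\in\mathcal{P}(\Omega)}\ \frac1{2\varepsilon}W_2^2(\mu_N,\rho)+H(\rho).$$ Let $\beta_1,\dots,\beta_N$ be the barycenters of the Laguerre cells $L_1,\dots,L_N$ of $\sigma_N$. Then $$W_2^2\Bigl(\sigma_N,\frac1N\sum_{i=1}^N\delta_{\beta_i}\Bigr)\le C(\Omega)\frac{\sqrt{\varepsilon}}{N}.$$
   Context: $\mathcal{P}(\Omega)$ is the set of probability measures on $\Omega$; $W_2$ is the quadratic Wasserstein distance. $H$ is Boltzmann's entropy: $H(\rho)=\int_\Omega\rho\log\rho\,dx$ if $\rho\in\mathcal{P}(\Omega)$ is absolutely continuous (identified with its density), $H(\rho)=+\infty$ otherwise. The minimizer $\sigma_N$ is unique. The Laguerre cells are $L_i=T^{-1}(\{x_i\})$, where $T$ is the ($\sigma_N$-a.e. unique) optimal transport map for the quadratic cost from $\sigma_N$ to $\mu_N$, and the barycenters are $\beta_i=N\int_{L_i}x\,d\sigma_N(x)$. *)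

theory Defs
  imports "HOL-Probability.Probability"
begin

text \<open>
  A probability measure on \<open>\<Omega>\<close> is represented as a Borel probability measure on the ambient
  space that gives full mass to \<open>\<Omega>\<close>.  In this way measures on \<open>\<Omega>\<close> and discrete measures whose
  atoms may lie outside \<open>\<Omega>\<close> have the same type.
\<close>

definition prob_measures_on :: "'a::euclidean_space set \<Rightarrow> 'a measure set" where
  "prob_measures_on \<Omega> = {\<rho>. sets \<rho> = sets borel \<and> prob_space \<rho> \<and> emeasure \<rho> \<Omega> = 1}"

definition couplings ::
  "'a::euclidean_space measure \<Rightarrow> 'a measure \<Rightarrow> ('a \<times> 'a) measure set" where
  "couplings \<mu> \<nu> = {\<gamma>. sets \<gamma> = sets (borel \<Otimes>\<^sub>M borel) \<and>
     distr \<gamma> borel fst = \<mu> \<and> distr \<gamma> borel snd = \<nu>}"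

text \<open>The square \<open>W\<^sub>2\<^sup>2\<close> of the quadratic Wasserstein distance.\<close>

definition W2_squared :: "'a::euclidean_space measure \<Rightarrow> 'a measure \<Rightarrow> ennreal" where
  "W2_squared \<mu> \<nu> = (INF \<gamma>\<in>couplings \<mu> \<nu>. \<integral>\<^sup>+ (x, y). ennreal ((dist x y)\<^sup>2) \<partial>\<gamma>)"

text \<open>
  The integral of \<open>\<rho> log \<rho>\<close> is the extended Lebesgue integral, positive part minus negative part,
  so that it equals \<open>\<infinity>\<close> if the positive part is not integrable; for bounded \<open>\<Omega>\<close> the negative
  part is always finite.  The convention \<open>0 log 0 = 0\<close> holds since \<open>ln 0 = 0\<close>.
\<close>

definition boltzmann_entropy :: "'a::euclidean_space set \<Rightarrow> 'a measure \<Rightarrow> ereal" where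
  "boltzmann_entropy \<Omega> \<rho> =
     (if \<rho> \<in> prob_measures_on \<Omega> \<and> absolutely_continuous lborel \<rho>
      then let f = (\<lambda>x. enn2real (RN_deriv lborel \<rho> x))
           in enn2ereal (\<integral>\<^sup>+ x\<in>\<Omega>. ennreal (f x * ln (f x)) \<partial>lborel)
            - enn2ereal (\<integral>\<^sup>+ x\<in>\<Omega>. ennreal (- (f x * ln (f x))) \<partial>lborel)
      else \<infinity>)"

text \<open>
  The push-forward of the uniform distribution on \<open>{1..N}\<close>, that is,
  \<open>(1 / N) * (\<Sum>i=1..N. \<delta> (x i))\<close>; see \<open>emeasure_empirical_measure\<close>.
\<close>

definition empirical_measure :: "nat \<Rightarrow> (nat \<Rightarrow> 'a::euclidean_space) \<Rightarrow> 'a measure" where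
  "empirical_measure N x = distr (uniform_count_measure {1..N}) borel x"

lemma emeasure_empirical_measure:
  fixes x :: "nat \<Rightarrow> 'a::euclidean_space"
  assumes "N \<ge> 1" and A: "A \<in> sets borel"
  shows "emeasure (empirical_measure N x) A
    = ennreal (1 / real N * (\<Sum>i=1..N. indicator A (x i)))"
proof -
  have "emeasure (empirical_measure N x) A
      = emeasure (uniform_count_measure {1..N}) (x -` A \<inter> {1..N})"
    unfolding empirical_measure_def
    by (subst emeasure_distr)
      (use A in \<open>auto simp: measurable_def sets_uniform_count_measure space_uniform_count_measure\<close>)
  also have "\<dots> = ennreal (real (card (x -` A \<inter> {1..N})) / real (card {1..N}))"
    by (rule emeasure_uniform_count_measure) auto
  also have "real (card (x -` A \<inter> {1..N})) = (\<Sum>i=1..N. indicator A (x i))"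
    by (simp add: indicator_def sum.If_cases vimage_def Int_commute)
  finally show ?thesis
    by simp
qed

definition regularized_functional ::
  "'a::euclidean_space set \<Rightarrow> real \<Rightarrow> 'a measure \<Rightarrow> 'a measure \<Rightarrow> ereal" where
  "regularized_functional \<Omega> \<epsilon> \<mu> \<rho> =
     ereal (1 / (2 * \<epsilon>)) * enn2ereal (W2_squared \<mu> \<rho>) + boltzmann_entropy \<Omega> \<rho>"

definition optimal_transport_map ::
  "'a::euclidean_space measure \<Rightarrow> 'a measure \<Rightarrow> ('a \<Rightarrow> 'a) \<Rightarrow> bool" where
  "optimal_transport_map \<sigma> \<mu> T \<longleftrightarrow>
     T \<in> measurable \<sigma> borel \<and> distr \<sigma> borel T = \<mu> \<and>
     (\<integral>\<^sup>+ x. ennreal ((dist x (T x))\<^sup>2) \<partial>\<sigma>) = W2_squared \<sigma> \<mu>"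

definition laguerre_cell :: "'a::euclidean_space set \<Rightarrow> ('a \<Rightarrow> 'a) \<Rightarrow> 'a \<Rightarrow> 'a set" where
  "laguerre_cell \<Omega> T y = {z \<in> \<Omega>. T z = y}"

text \<open>Each of the \<open>N\<close> cells has mass \<open>1 / N\<close>, hence the factor \<open>N\<close>.\<close>

definition cell_barycenter :: "nat \<Rightarrow> 'a::euclidean_space measure \<Rightarrow> 'a set \<Rightarrow> 'a" where
  "cell_barycenter N \<sigma> L = real N *\<^sub>R (LINT z:L|\<sigma>. z)"

end

theory Submission
  imports Defs
begin

text \<open>
  The transport that sends every Laguerre cell to its barycenter costs the sum, over the cells, of
  the unnormalized variances \<open>V i = \<integral>\<^bsub>L i\<^esub> (z - \<beta> i)\<^sup>2 d\<sigma>\<close> (\<open>W2_squared_cells_le\<close>).  On the line an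
  optimal map is monotone, so up to null sets the cells are disjoint open intervals \<open>(a i, b i)\<close>
  contained in \<open>\<Omega>\<close> (\<open>optimal_cells_are_intervals\<close>), each of mass \<open>1 / N\<close>.  It therefore suffices
  to show \<open>V i \<le> 2 \<surd>\<epsilon> (b i - a i) / N\<close>: the lengths add up to at most the length of \<open>\<Omega>\<close>, and
  \<open>C = 2 |\<Omega>|\<close> works.

  This bound is the geometric mean of two others (\<open>cell_variance_le\<close>).  Trivially
  \<open>V i \<le> (b i - a i)\<^sup>2 / N\<close>.  On the other hand \<open>V i \<le> 4 \<epsilon> / N\<close>
  (\<open>minimizer_variance_bound\<close>).  Up to the constant this is expected from the form of the minimizer,
  which on a cell is a Gaussian of variance \<open>\<epsilon>\<close> restricted to an interval, and restriction does not
  increase the variance; but it follows directly from minimality by one explicit competitor.  Contract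
  the cell by the factor \<open>1/2\<close> towards its barycenter.  The cell being an interval, the contracted mass
  stays inside it and meets no other mass, so the entropy increases by exactly \<open>ln 2 / N\<close>
  (\<open>boltzmann_entropy_contract\<close>), while the squared transport cost decreases by \<open>3/4 V i\<close> because the
  first moment about the barycenter vanishes.  Minimality gives \<open>3/4 V i / (2 \<epsilon>) \<le> ln 2 / N\<close>.
\<close>

section \<open>Couplings given by pairs of maps\<close>

text \<open>
  A transport cost is only ever bounded from above here, and always by writing both marginals as
  images of one measure.
\<close>

lemma W2_squared_le_maps:
  fixes f g :: "'b \<Rightarrow> 'a::euclidean_space"
  assumes [measurable]: "f \<in> borel_measurable M" "g \<in> borel_measurable M"
  shows "W2_squared (distr M borel f) (distr M borel g) \<le> (\<integral>\<^sup>+ z. ennreal ((dist (f z) (g z))\<^sup>2) \<partial>M)"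
proof -
  define \<gamma> where "\<gamma> = distr M (borel \<Otimes>\<^sub>M borel) (\<lambda>z. (f z, g z))"
  have "\<gamma> \<in> couplings (distr M borel f) (distr M borel g)"
    unfolding couplings_def \<gamma>_def by (simp add: distr_distr o_def)
  then have "W2_squared (distr M borel f) (distr M borel g)
      \<le> (\<integral>\<^sup>+ (x, y). ennreal ((dist x y)\<^sup>2) \<partial>\<gamma>)"
    unfolding W2_squared_def by (rule INF_lower)
  also have "\<dots> = (\<integral>\<^sup>+ z. ennreal ((dist (f z) (g z))\<^sup>2) \<partial>M)"
    unfolding \<gamma>_def by (subst nn_integral_distr) (auto simp: case_prod_beta)
  finally show ?thesis .
qed

lemma W2_squared_commute_le:
  fixes \<mu> :: "'a::euclidean_space measure"
  shows "W2_squared \<nu> \<mu> \<le> W2_squared \<mu> \<nu>"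
  unfolding W2_squared_def [of \<mu> \<nu>]
proof (rule INF_greatest)
  fix \<gamma> :: "('a \<times> 'a) measure" assume "\<gamma> \<in> couplings \<mu> \<nu>"
  then have s: "sets \<gamma> = sets (borel \<Otimes>\<^sub>M borel)"
    and m: "distr \<gamma> borel fst = \<mu>" "distr \<gamma> borel snd = \<nu>" by (auto simp: couplings_def)
  note [measurable_cong] = s
  have "W2_squared (distr \<gamma> borel snd) (distr \<gamma> borel fst)
     \<le> (\<integral>\<^sup>+ z. ennreal ((dist (snd z) (fst z))\<^sup>2) \<partial>\<gamma>)"
    by (rule W2_squared_le_maps) measurable
  then show "W2_squared \<nu> \<mu> \<le> (\<integral>\<^sup>+ (x, y). ennreal ((dist x y)\<^sup>2) \<partial>\<gamma>)"
    by (simp add: m case_prod_unfold dist_commute)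
qed

lemma W2_squared_commute:
  fixes \<mu> :: "'a::euclidean_space measure"
  shows "W2_squared \<mu> \<nu> = W2_squared \<nu> \<mu>"
  by (intro antisym W2_squared_commute_le)

section \<open>Boltzmann entropy of a density\<close>

text \<open>
  The entropy is defined through a Radon--Nikodym derivative; for a concrete density the derivative
  agrees with it almost everywhere, and the difference of extended integrals collapses to one
  Bochner integral.
\<close>

lemma boltzmann_entropy_density:
  fixes f :: "'a::euclidean_space \<Rightarrow> real"
  assumes \<rho>: "\<rho> = density lborel (\<lambda>x. ennreal (f x))" "\<rho> \<in> prob_measures_on \<Omega>"
    and [measurable]: "f \<in> borel_measurable borel" "\<Omega> \<in> sets borel"
    and f0: "\<And>x. 0 \<le> f x"
    and int: "integrable lborel (\<lambda>x. indicator \<Omega> x * (f x * ln (f x)))"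
  shows "boltzmann_entropy \<Omega> \<rho> = ereal (LINT x|lborel. indicator \<Omega> x * (f x * ln (f x)))"
proof -
  let ?h = "\<lambda>x. indicator \<Omega> x * (f x * ln (f x))"
  have ac: "absolutely_continuous lborel \<rho>"
    unfolding \<rho>(1) by (rule absolutely_continuousI_density) measurable
  have AE: "AE x in lborel. ennreal (f x) = RN_deriv lborel \<rho> x"
    by (rule sigma_finite_measure.RN_deriv_unique [OF sigma_finite_lborel]) (auto simp: \<rho>(1))
  then have AE: "AE x in lborel. enn2real (RN_deriv lborel \<rho> x) = f x"
    by eventually_elim (metis enn2real_ennreal f0)
  have pos: "(\<integral>\<^sup>+ x\<in>\<Omega>. ennreal (enn2real (RN_deriv lborel \<rho> x) * ln (enn2real (RN_deriv lborel \<rho> x))) \<partial>lborel)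
      = (\<integral>\<^sup>+ x. ennreal (?h x) \<partial>lborel)"
    using AE by (intro nn_integral_cong_AE) (auto elim!: eventually_mono simp: indicator_def)
  have neg: "(\<integral>\<^sup>+ x\<in>\<Omega>. ennreal (- (enn2real (RN_deriv lborel \<rho> x) * ln (enn2real (RN_deriv lborel \<rho> x)))) \<partial>lborel)
      = (\<integral>\<^sup>+ x. ennreal (- ?h x) \<partial>lborel)"
    using AE by (intro nn_integral_cong_AE) (auto elim!: eventually_mono simp: indicator_def)
  have fin: "(\<integral>\<^sup>+ x. ennreal (?h x) \<partial>lborel) \<noteq> \<infinity>" "(\<integral>\<^sup>+ x. ennreal (- ?h x) \<partial>lborel) \<noteq> \<infinity>"
    using int unfolding real_integrable_def by auto
  have "boltzmann_entropy \<Omega> \<rho> = enn2ereal (\<integral>\<^sup>+ x. ennreal (?h x) \<partial>lborel) - enn2ereal (\<integral>\<^sup>+ x. ennreal (- ?h x) \<partial>lborel)"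
    unfolding boltzmann_entropy_def using ac \<rho>(2) by (simp add: Let_def pos neg)
  also have "\<dots> = ereal (enn2real (\<integral>\<^sup>+ x. ennreal (?h x) \<partial>lborel) - enn2real (\<integral>\<^sup>+ x. ennreal (- ?h x) \<partial>lborel))"
    using fin by (cases "\<integral>\<^sup>+ x. ennreal (?h x) \<partial>lborel"; cases "\<integral>\<^sup>+ x. ennreal (- ?h x) \<partial>lborel") (auto simp: enn2ereal_ennreal)
  also have "\<dots> = ereal (LINT x|lborel. ?h x)"
    by (simp add: real_lebesgue_integral_def [OF int])
  finally show ?thesis .
qed

lemma neg_x_ln_x_le_one: "- (t * ln t) \<le> (1::real)" if "0 \<le> t"
proof (cases "t = 0")
  case False
  with that have "ln (1 / t) \<le> 1 / t - 1" by (intro ln_le_minus_one) auto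
  with False that have "t * (- ln t) \<le> t * (1 / t - 1)" by (intro mult_left_mono) (auto simp: ln_div)
  also have "\<dots> \<le> 1" using False that by (simp add: field_simps)
  finally show ?thesis by simp
qed auto

text \<open>
  Finiteness of the entropy controls only the positive part of \<open>f ln f\<close>.  The negative part is
  integrable for free, because \<open>- t ln t \<le> 1\<close> and \<open>\<Omega>\<close> is bounded.
\<close>

lemma finite_entropy_density:
  fixes \<Omega> :: "'a::euclidean_space set"
  assumes fin: "boltzmann_entropy \<Omega> \<rho> < \<infinity>"
    and \<Omega> [measurable]: "\<Omega> \<in> sets borel" and bnd: "bounded \<Omega>"
  obtains f :: "'a \<Rightarrow> real" where "f \<in> borel_measurable borel" "\<And>x. 0 \<le> f x"
    "\<rho> = density lborel (\<lambda>x. ennreal (f x))"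
    "integrable lborel (\<lambda>x. indicator \<Omega> x * (f x * ln (f x)))"
proof -
  define f where "f = (\<lambda>x. enn2real (RN_deriv lborel \<rho> x))"
  have P: "\<rho> \<in> prob_measures_on \<Omega>" and ac: "absolutely_continuous lborel \<rho>"
    using fin by (auto simp: boltzmann_entropy_def split: if_splits)
  then have s: "sets \<rho> = sets borel" and "prob_space \<rho>" by (auto simp: prob_measures_on_def)
  then interpret \<rho>: prob_space \<rho> by simp
  have "sets \<rho> = sets (lborel :: 'a measure)" using s by simp
  then have AE: "AE x in lborel. RN_deriv lborel \<rho> x \<noteq> \<infinity>"
    using ac by (intro sigma_finite_measure.RN_deriv_finite [OF sigma_finite_lborel]) (auto intro: \<rho>.sigma_finite_measure_axioms)
  have [measurable]: "f \<in> borel_measurable borel" unfolding f_def by measurable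
  have "\<rho> = density lborel (RN_deriv lborel \<rho>)"
    using ac s by (simp add: sigma_finite_measure.density_RN_deriv [OF sigma_finite_lborel])
  also have "\<dots> = density lborel (\<lambda>x. ennreal (f x))"
    using AE by (intro density_cong) (auto elim!: eventually_mono simp: f_def ennreal_enn2real_if infinity_ennreal_def)
  finally have \<rho>: "\<rho> = density lborel (\<lambda>x. ennreal (f x))" .
  let ?h = "\<lambda>x. indicator \<Omega> x * (f x * ln (f x))"
  have eq: "ennreal (?h x) = ennreal (f x * ln (f x)) * indicator \<Omega> x"
    "ennreal (- ?h x) = ennreal (- (f x * ln (f x))) * indicator \<Omega> x" for x
    by (auto simp: indicator_def)
  have "(\<integral>\<^sup>+ x. ennreal (- ?h x) \<partial>lborel) \<le> (\<integral>\<^sup>+ x. indicator \<Omega> x \<partial>lborel)"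
    unfolding eq using neg_x_ln_x_le_one[of "f _"]
    by (intro nn_integral_mono) (auto simp: indicator_def f_def intro!: ennreal_leI [where ?y = 1, simplified])
  also have "\<dots> < \<infinity>" using emeasure_bounded_finite [OF bnd] by simp
  finally have neg: "(\<integral>\<^sup>+ x. ennreal (- ?h x) \<partial>lborel) \<noteq> \<infinity>" by simp
  have "boltzmann_entropy \<Omega> \<rho> = enn2ereal (\<integral>\<^sup>+ x. ennreal (?h x) \<partial>lborel) - enn2ereal (\<integral>\<^sup>+ x. ennreal (- ?h x) \<partial>lborel)"
    unfolding boltzmann_entropy_def eq using P ac by (simp add: Let_def f_def)
  with fin neg have pos: "(\<integral>\<^sup>+ x. ennreal (?h x) \<partial>lborel) \<noteq> \<infinity>"
    by (cases "\<integral>\<^sup>+ x. ennreal (- ?h x) \<partial>lborel") (auto simp: enn2ereal_ennreal)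
  have "integrable lborel ?h"
    unfolding real_integrable_def using pos neg by auto
  with \<rho> show ?thesis by (intro that[of f]) (auto simp: f_def)
qed

section \<open>Measures carried by a bounded set\<close>

lemma (in finite_measure) integrable_indicator_times_bounded:
  fixes g :: "'a \<Rightarrow> real"
  assumes [measurable]: "A \<in> sets M" "g \<in> borel_measurable M" and bound: "\<And>z. z \<in> A \<Longrightarrow> \<bar>g z\<bar> \<le> K"
  shows "integrable M (\<lambda>z. indicator A z * g z)"
  using bound
  by (intro integrable_const_bound [where B = "max 0 K"]) (auto simp: indicator_def le_max_iff_disj)

lemma AE_prob_measures_on:
  assumes "\<sigma> \<in> prob_measures_on \<Omega>" "\<Omega> \<in> sets borel"
  shows "AE z in \<sigma>. z \<in> \<Omega>"
proof -
  interpret prob_space \<sigma> using assms by (simp add: prob_measures_on_def)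
  show ?thesis
    using assms by (intro AE_in_set_eq_1 [THEN iffD2]) (auto simp: prob_measures_on_def measure_def)
qed

section \<open>Optimal maps on the line are monotone\<close>

text \<open>
  The distribution function of an atomless measure is continuous, so cutting \<open>A\<close> by a half-line
  attains every intermediate mass.
\<close>

lemma subset_of_given_measure:
  fixes M :: "real measure"
  assumes "finite_measure M" and s: "sets M = sets borel"
    and atomless: "\<And>z. measure M {z} = 0"
    and A: "A \<in> sets borel" and m: "0 < m" "m \<le> measure M A"
  obtains B where "B \<in> sets borel" "B \<subseteq> A" "measure M B = m"
proof -
  interpret M: finite_measure M by fact
  note [measurable_cong] = s and [measurable] = A
  define D where "D = density M (indicator A)"
  have emD: "emeasure D X = emeasure M (A \<inter> X)" if "X \<in> sets borel" for X
    unfolding D_def using that s A by (intro emeasure_restricted) auto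
  have meD: "measure D X = measure M (A \<inter> X)" if "X \<in> sets borel" for X
    using emD [OF that] by (simp add: measure_def)
  have sp: "space D = UNIV" using sets_eq_imp_space_eq [OF s] by (simp add: D_def)
  have "finite_measure D"
    unfolding D_def using s A by (intro M.finite_measure_restricted) simp
  then interpret D: finite_borel_measure D
    using s by (simp add: finite_borel_measure_def finite_borel_measure_axioms_def D_def)
  have cont: "isCont (cdf D) t" for t
    using D.isCont_cdf meD [of "{t}"] M.finite_measure_mono [of "A \<inter> {t}" "{t}"] atomless [of t] s
    by (simp add: measure_le_0_iff)
  have bot: "(cdf D \<longlongrightarrow> 0) at_bot" by (rule D.cdf_lim_at_bot)
  have top: "(cdf D \<longlongrightarrow> measure M A) at_top"
    using D.cdf_lim_at_top meD [of UNIV] sp by simp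
  show ?thesis
  proof (cases "m = measure M A")
    case True
    then show ?thesis using that A by blast
  next
    case False
    have "eventually (\<lambda>t. cdf D t < m) at_bot" using order_tendstoD(2) [OF bot m(1)] .
    then obtain u where u: "cdf D u < m" by (auto simp: eventually_at_bot_linorder)
    have "eventually (\<lambda>t. m < cdf D t) at_top" using order_tendstoD(1) [OF top, of m] m(2) False by simp
    then obtain v where v: "m < cdf D v" by (auto simp: eventually_at_top_linorder)
    have "u \<le> v" using u v D.cdf_nondecreasing [of v u] by force
    then obtain t where "cdf D t = m"
      using IVT' [of "cdf D" u m v] u v cont by (auto intro: continuous_at_imp_continuous_on)
    then show ?thesis using that [of "A \<inter> {..t}"] A meD[of "{..t}"] by (simp add: cdf_def)
  qed
qed

text \<open>
  An exchange argument.  If mass sent to \<open>p\<close> lay to the right of \<open>c\<close> and mass sent to the larger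
  \<open>q\<close> lay to its left, then exchanging the targets of two pieces of equal mass would keep the image
  measure and lower the cost.
\<close>

lemma optimal_transport_map_monotone:
  fixes \<sigma> \<mu> :: "real measure" and T :: "real \<Rightarrow> real"
  assumes "prob_space \<sigma>" and s: "sets \<sigma> = sets borel"
    and atomless: "\<And>z. measure \<sigma> {z} = 0"
    and T: "optimal_transport_map \<sigma> \<mu> T"
    and int: "integrable \<sigma> (\<lambda>z. (z - T z)\<^sup>2)"
    and "p < q"
  shows "measure \<sigma> {z. T z = p \<and> c < z} = 0 \<or> measure \<sigma> {z. T z = q \<and> z < c} = 0"
proof (rule ccontr)
  assume not: "\<not> ?thesis"
  interpret prob_space \<sigma> by fact
  note [measurable_cong] = s
  have [simp]: "space \<sigma> = UNIV" using sets_eq_imp_space_eq [OF s] by simp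
  have [measurable]: "T \<in> borel_measurable borel" and \<mu>: "distr \<sigma> borel T = \<mu>"
    and opt: "(\<integral>\<^sup>+ z. ennreal ((dist z (T z))\<^sup>2) \<partial>\<sigma>) = W2_squared \<sigma> \<mu>"
    using T s by (auto simp: optimal_transport_map_def cong: measurable_cong_sets)
  define m where "m = min (measure \<sigma> {z. T z = p \<and> c < z}) (measure \<sigma> {z. T z = q \<and> z < c})"
  have m: "0 < m" using not unfolding m_def by (simp add: zero_less_measure_iff)
  have fin: "finite_measure \<sigma>" by (rule finite_measure_axioms)
  have "{z. T z = p \<and> c < z} \<in> sets borel" "{z. T z = q \<and> z < c} \<in> sets borel" by measurable
  note * = subset_of_given_measure [OF fin s atomless _ m]
  obtain A where A [measurable]: "A \<in> sets borel" and Ap: "A \<subseteq> {z. T z = p \<and> c < z}" and Am: "measure \<sigma> A = m"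
    using * [of "{z. T z = p \<and> c < z}"] m_def by auto
  obtain B where B [measurable]: "B \<in> sets borel" and Bq: "B \<subseteq> {z. T z = q \<and> z < c}" and Bm: "measure \<sigma> B = m"
    using * [of "{z. T z = q \<and> z < c}"] m_def by auto
  define T' where "T' z = (if z \<in> A then q else if z \<in> B then p else T z)" for z
  have [measurable]: "T' \<in> borel_measurable borel" unfolding T'_def by measurable
  have "distr \<sigma> borel T' = distr \<sigma> borel T"
  proof (rule measure_eqI)
    fix E :: "real set" assume "E \<in> sets (distr \<sigma> borel T')"
    then have [measurable]: "E \<in> sets borel" by simp
    have [measurable]: "T -` E \<in> sets borel" "T' -` E \<in> sets borel"
      using measurable_sets_borel [of T borel E] measurable_sets_borel [of T' borel E] by auto
    have ind: "(LINT z|\<sigma>. indicator E (f z)) = measure \<sigma> (f -` E)" for f :: "real \<Rightarrow> real"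
    proof -
      have "(\<lambda>z. indicator E (f z)) = (indicator (f -` E) :: real \<Rightarrow> real)" by (auto simp: indicator_def)
      then show ?thesis by (metis Bochner_Integration.integral_indicator Int_UNIV_right \<open>space \<sigma> = UNIV\<close>)
    qed
    have "measure \<sigma> (T' -` E) = (LINT z|\<sigma>. indicator E (T' z))"
      by (rule ind [symmetric])
    also have "\<dots> = (LINT z|\<sigma>. indicator E (T z) + (indicator E q - indicator E p) * (indicator A z - indicator B z))"
      using Ap Bq by (intro Bochner_Integration.integral_cong) (auto simp: indicator_def T'_def)
    also have "\<dots> = (LINT z|\<sigma>. indicator E (T z)) + (LINT z|\<sigma>. (indicator E q - indicator E p) * (indicator A z - indicator B z))"
      by (intro Bochner_Integration.integral_add integrable_const_bound [where B = 1]
          integrable_mult_right Bochner_Integration.integrable_diff) (auto simp: emeasure_eq_measure indicator_def)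
    also have "\<dots> = measure \<sigma> (T -` E)"
      by (simp add: ind emeasure_eq_measure Am Bm)
    finally have "measure \<sigma> (T' -` E) = measure \<sigma> (T -` E)" .
    then show "emeasure (distr \<sigma> borel T') E = emeasure (distr \<sigma> borel T) E"
      by (simp add: emeasure_distr emeasure_eq_measure)
  qed simp
  then have \<mu>': "distr \<sigma> borel T' = \<mu>" using \<mu> by simp
  have "distr \<sigma> borel (\<lambda>z. z) = \<sigma>" using s by (intro distr_id2) simp
  with W2_squared_le_maps [of "\<lambda>z. z" \<sigma> T'] have "W2_squared \<sigma> \<mu> \<le> (\<integral>\<^sup>+ z. ennreal ((dist z (T' z))\<^sup>2) \<partial>\<sigma>)"
    by (simp add: \<mu>')
  then have le: "(\<integral>\<^sup>+ z. ennreal ((z - T z)\<^sup>2) \<partial>\<sigma>) \<le> (\<integral>\<^sup>+ z. ennreal ((z - T' z)\<^sup>2) \<partial>\<sigma>)"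
    by (simp add: opt [symmetric] dist_real_def)
  \<comment> \<open>The change of cost at a point of \<open>A\<close> is affine in \<open>z\<close>; \<open>\<kappa>\<close> is its value at the threshold \<open>c\<close>. Since \<open>A\<close> and \<open>B\<close>
    have equal mass, adding \<open>\<kappa>\<close> on \<open>A\<close> and subtracting it on \<open>B\<close> does not change the integral, and
    it makes the gain \<open>h\<close> nonnegative at every point.\<close>
  define \<kappa> where "\<kappa> = (q - p) * (p + q - 2 * c)"
  define h where "h z = (z - T z)\<^sup>2 + \<kappa> * (indicator A z - indicator B z) - (z - T' z)\<^sup>2" for z
  have hA: "h z = 2 * (q - p) * (z - c)" if "z \<in> A" for z
  proof -
    have "z \<notin> B" "T z = p" using that Ap Bq \<open>p < q\<close> by auto
    with that show ?thesis by (simp add: h_def T'_def \<kappa>_def power2_eq_square algebra_simps)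
  qed
  have hB: "h z = 2 * (q - p) * (c - z)" if "z \<in> B" for z
  proof -
    have "z \<notin> A" "T z = q" using that Ap Bq \<open>p < q\<close> by auto
    with that show ?thesis by (simp add: h_def T'_def \<kappa>_def power2_eq_square algebra_simps)
  qed
  have h0: "0 \<le> h z" for z
    using hA [of z] hB [of z] Ap Bq \<open>p < q\<close> by (cases "z \<in> A"; cases "z \<in> B") (auto simp: h_def T'_def)
  have intAB: "integrable \<sigma> (\<lambda>z. \<kappa> * (indicator A z - indicator B z))" by (simp add: emeasure_eq_measure)
  have AB0: "(LINT z|\<sigma>. \<kappa> * (indicator A z - indicator B z)) = 0"
    by (simp add: emeasure_eq_measure Am Bm)
  have int': "integrable \<sigma> (\<lambda>z. (z - T' z)\<^sup>2)"
  proof (rule Bochner_Integration.integrable_bound)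
    show "integrable \<sigma> (\<lambda>z. (z - T z)\<^sup>2 + \<kappa> * (indicator A z - indicator B z))"
      using int intAB by simp
    show "AE z in \<sigma>. norm ((z - T' z)\<^sup>2) \<le> norm ((z - T z)\<^sup>2 + \<kappa> * (indicator A z - indicator B z))"
    proof (rule AE_I2)
      fix z show "norm ((z - T' z)\<^sup>2) \<le> norm ((z - T z)\<^sup>2 + \<kappa> * (indicator A z - indicator B z))"
        using h0 [of z] unfolding h_def by simp
    qed
  qed measurable
  have inth: "integrable \<sigma> h" unfolding h_def using int intAB int' by simp
  have "(LINT z|\<sigma>. (z - T z)\<^sup>2) \<le> (LINT z|\<sigma>. (z - T' z)\<^sup>2)"
    using le by (simp add: nn_integral_eq_integral int int')
  moreover have "(LINT z|\<sigma>. h z) = (LINT z|\<sigma>. (z - T z)\<^sup>2) - (LINT z|\<sigma>. (z - T' z)\<^sup>2)"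
    unfolding h_def using int intAB int' AB0 by simp
  ultimately have "(LINT z|\<sigma>. h z) = 0"
    using integral_nonneg_AE [of h \<sigma>] h0 by (simp add: antisym)
  then have "AE z in \<sigma>. h z = 0"
    using integral_nonneg_eq_0_iff_AE [OF inth] h0 by simp
  then have "AE z in \<sigma>. z \<notin> A"
    by eventually_elim (use hA Ap \<open>p < q\<close> in fastforce)
  then have "measure \<sigma> A = 0" by (simp add: prob_eq_0)
  with Am m show False by simp
qed

section \<open>Essential hulls and the shape of the cells\<close>

text \<open>
  \<open>b\<close> is the supremum of the levels above which \<open>P\<close> still has mass.  Beyond \<open>b\<close> itself nothing is left
  because the half-line \<open>{b<..}\<close> is a countable union of half-lines that start strictly above \<open>b\<close>.
\<close>

lemma essential_supremum:
  fixes M :: "real measure"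
  assumes "finite_measure M" and s: "sets M = sets borel" and P [measurable]: "P \<in> sets borel"
    and bnd: "bounded P" and pos: "0 < measure M P"
  obtains b where "measure M (P \<inter> {b<..}) = 0" "\<And>s. s < b \<Longrightarrow> 0 < measure M (P \<inter> {s<..})"
proof -
  interpret finite_measure M by fact
  note [measurable_cong] = s
  obtain K where K: "\<And>z. z \<in> P \<Longrightarrow> \<bar>z\<bar> \<le> K" using bnd by (auto simp: bounded_iff)
  define U where "U = {s. 0 < measure M (P \<inter> {s<..})}"
  have "P \<inter> {- K - 1<..} = P" using K by fastforce
  with pos have ne: "U \<noteq> {}" unfolding U_def by (metis (mono_tags) empty_iff mem_Collect_eq)
  have "s \<le> K" if "s \<in> U" for s
  proof (rule ccontr)
    assume "\<not> s \<le> K"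
    then have "P \<inter> {s<..} = {}" using K by fastforce
    with that show False by (simp add: U_def)
  qed
  then have above: "bdd_above U" unfolding bdd_above_def by blast
  show ?thesis
  proof
    have "P \<inter> {Sup U<..} = (\<Union>n. P \<inter> {Sup U + 1 / Suc n<..})"
    proof (intro equalityI subsetI)
      fix z assume z: "z \<in> P \<inter> {Sup U<..}"
      then obtain n where "1 / Suc n < z - Sup U" using reals_Archimedean [of "z - Sup U"] by (auto simp: field_simps)
      with z show "z \<in> (\<Union>n. P \<inter> {Sup U + 1 / Suc n<..})" by (auto intro!: exI [of _ n])
    next
      fix z assume "z \<in> (\<Union>n. P \<inter> {Sup U + 1 / Suc n<..})"
      then obtain n where "z \<in> P" "Sup U + 1 / Suc n < z" by auto
      moreover have "0 < 1 / real (Suc n)" by simp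
      ultimately have "Sup U < z" by linarith
      with \<open>z \<in> P\<close> show "z \<in> P \<inter> {Sup U<..}" by simp
    qed
    moreover have *: "P \<inter> {Sup U + 1 / Suc n<..} \<in> null_sets M" for n
    proof -
      have "Sup U + 1 / Suc n \<notin> U" using cSup_upper [OF _ above, of "Sup U + 1 / Suc n"] by force
      then show ?thesis by (auto simp: U_def not_less null_sets_def emeasure_eq_measure measure_le_0_iff)
    qed
    have "(\<Union>n. P \<inter> {Sup U + 1 / Suc n<..}) \<in> null_sets M" using * by (rule null_sets_UN)
    ultimately have "P \<inter> {Sup U<..} \<in> null_sets M" by (simp only:)
    then show "measure M (P \<inter> {Sup U<..}) = 0" by (simp add: measure_eq_0_null_sets)
  next
    fix s assume "s < Sup U"
    then obtain t where "t \<in> U" "s < t" using less_cSupE [OF _ ne] by blast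
    then have "measure M (P \<inter> {t<..}) \<le> measure M (P \<inter> {s<..})" by (intro finite_measure_mono) auto
    then show "0 < measure M (P \<inter> {s<..})" using \<open>t \<in> U\<close> by (simp add: U_def)
  qed
qed

lemma essential_infimum:
  fixes M :: "real measure"
  assumes "finite_measure M" and s: "sets M = sets borel" and P [measurable]: "P \<in> sets borel"
    and bnd: "bounded P" and pos: "0 < measure M P"
  obtains a where "measure M (P \<inter> {..<a}) = 0" "\<And>s. a < s \<Longrightarrow> 0 < measure M (P \<inter> {..<s})"
proof -
  interpret finite_measure M by fact
  note [measurable_cong] = s
  have sp: "space M = UNIV" using sets_eq_imp_space_eq [OF s] by simp
  define R where "R = distr M borel uminus"
  have R: "measure R (uminus ` P \<inter> {c<..}) = measure M (P \<inter> {..<-c})" for c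
  proof -
    have "uminus -` (uminus ` P \<inter> {c<..}) = P \<inter> {..<-c}" by force
    moreover have "uminus ` P = uminus -` P" by force
    ultimately show ?thesis unfolding R_def by (subst measure_distr) (auto simp: sp)
  qed
  have "uminus ` P = uminus -` P" by force
  then have [measurable]: "uminus ` P \<in> sets borel" using measurable_sets_borel [OF _ P, of uminus] by simp
  have "uminus -` uminus ` P = P" by force
  then have "0 < measure R (uminus ` P)" unfolding R_def using pos by (subst measure_distr) (auto simp: sp)
  then obtain b where "measure R (uminus ` P \<inter> {b<..}) = 0" "\<And>s. s < b \<Longrightarrow> 0 < measure R (uminus ` P \<inter> {s<..})"
    using essential_supremum [of R "uminus ` P"] bnd finite_measure_distr [of uminus borel]
    by (auto simp: R_def)
  then show ?thesis using that [of "- b"] by (metis R minus_less_iff minus_minus)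
qed

text \<open>
  Each cell fills, up to a null set, the interior of its essential hull.  Monotonicity of the map
  forces the hulls of two cells not to overlap.  As the cells exhaust \<open>\<sigma>\<close>, no mass of another cell
  remains inside a hull, so on that interval \<open>\<sigma>\<close> is exactly the cell.
\<close>

lemma optimal_cells_are_intervals:
  fixes \<sigma> \<mu> :: "real measure" and T :: "real \<Rightarrow> real" and x :: "'i \<Rightarrow> real"
  assumes P: "\<sigma> \<in> prob_measures_on \<Omega>" and \<Omega>: "is_interval \<Omega>" "bounded \<Omega>" "\<Omega> \<in> sets borel"
    and atomless: "\<And>z. measure \<sigma> {z} = 0"
    and T: "optimal_transport_map \<sigma> \<mu> T" and int: "integrable \<sigma> (\<lambda>z. (z - T z)\<^sup>2)"
    and I: "finite I" "inj_on x I" and pos: "\<And>i. i \<in> I \<Longrightarrow> 0 < measure \<sigma> {z \<in> \<Omega>. T z = x i}"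
    and cover: "AE z in \<sigma>. T z \<in> x ` I"
  obtains a b where "\<And>i. i \<in> I \<Longrightarrow> {a i<..<b i} \<subseteq> \<Omega>"
    "disjoint_family_on (\<lambda>i. {a i<..<b i}) I"
    "AE z in \<sigma>. \<forall>i\<in>I. z \<in> {a i<..<b i} \<longleftrightarrow> z \<in> \<Omega> \<and> T z = x i"
proof -
  have s [measurable_cong]: "sets \<sigma> = sets borel" and "prob_space \<sigma>"
    using P by (auto simp: prob_measures_on_def)
  then interpret prob_space \<sigma> by simp
  have sp: "space \<sigma> = UNIV" using sets_eq_imp_space_eq [OF s] by simp
  note [measurable] = \<Omega>(3)
  have [measurable]: "T \<in> borel_measurable borel"
    using T s by (auto simp: optimal_transport_map_def cong: measurable_cong_sets)
  define L where "L i = {z \<in> \<Omega>. T z = x i}" for i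
  have L [measurable]: "L i \<in> sets borel" for i unfolding L_def by measurable
  have Lb: "bounded (L i)" for i using \<Omega>(2) by (rule bounded_subset) (auto simp: L_def)
  have "\<exists>b. measure \<sigma> (L i \<inter> {b<..}) = 0 \<and> (\<forall>s<b. 0 < measure \<sigma> (L i \<inter> {s<..}))" if "i \<in> I" for i
    using essential_supremum [OF finite_measure_axioms s L Lb pos [OF that, folded L_def]] by metis
  then obtain b where b: "\<And>i. i \<in> I \<Longrightarrow> measure \<sigma> (L i \<inter> {b i<..}) = 0"
    "\<And>i s. i \<in> I \<Longrightarrow> s < b i \<Longrightarrow> 0 < measure \<sigma> (L i \<inter> {s<..})" by metis
  have "\<exists>a. measure \<sigma> (L i \<inter> {..<a}) = 0 \<and> (\<forall>s>a. 0 < measure \<sigma> (L i \<inter> {..<s}))" if "i \<in> I" for i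
    using essential_infimum [OF finite_measure_axioms s L Lb pos [OF that, folded L_def]] by metis
  then obtain a where a: "\<And>i. i \<in> I \<Longrightarrow> measure \<sigma> (L i \<inter> {..<a i}) = 0"
    "\<And>i s. i \<in> I \<Longrightarrow> a i < s \<Longrightarrow> 0 < measure \<sigma> (L i \<inter> {..<s})" by metis
  have ne: "\<exists>z. z \<in> A" if "0 < measure \<sigma> A" for A using that by (cases "A = {}") auto
  have sub: "{a i<..<b i} \<subseteq> \<Omega>" if i: "i \<in> I" for i
  proof
    fix z assume z: "z \<in> {a i<..<b i}"
    obtain u where "u \<in> \<Omega>" "u < z" using ne [OF a(2) [OF i, of z]] z by (auto simp: L_def)
    moreover obtain v where "v \<in> \<Omega>" "z < v" using ne [OF b(2) [OF i, of z]] z by (auto simp: L_def)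
    ultimately show "z \<in> \<Omega>" using \<Omega>(1) by (meson is_interval_1 less_imp_le)
  qed
  have order: "b i \<le> a j" if ij: "i \<in> I" "j \<in> I" "x i < x j" for i j
  proof (rule ccontr)
    assume "\<not> b i \<le> a j"
    then obtain c where c: "a j < c" "c < b i" using dense by (meson not_le)
    have "0 < measure \<sigma> (L i \<inter> {c<..})" "0 < measure \<sigma> (L j \<inter> {..<c})" using a b c ij by auto
    moreover have "measure \<sigma> (L i \<inter> {c<..}) \<le> measure \<sigma> {z. T z = x i \<and> c < z}"
      "measure \<sigma> (L j \<inter> {..<c}) \<le> measure \<sigma> {z. T z = x j \<and> z < c}"
      by (intro finite_measure_mono; auto simp: L_def s)+
    ultimately show False
      using optimal_transport_map_monotone [OF \<open>prob_space \<sigma>\<close> s atomless T int ij(3), of c] by linarith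
  qed
  have disj: "disjoint_family_on (\<lambda>i. {a i<..<b i}) I"
    unfolding disjoint_family_on_def
  proof (intro ballI impI)
    fix i j assume "i \<in> I" "j \<in> I" "i \<noteq> j"
    then have "x i < x j \<or> x j < x i" using I(2) by (metis inj_on_def linorder_less_linear)
    then show "{a i<..<b i} \<inter> {a j<..<b j} = {}" using order \<open>i \<in> I\<close> \<open>j \<in> I\<close> by fastforce
  qed
  have AE0: "AE z in \<sigma>. z \<notin> A" if "measure \<sigma> A = 0" and [measurable]: "A \<in> sets borel" for A
    using that prob_eq_0 [of A] by (simp add: s)
  have "AE z in \<sigma>. \<forall>i\<in>I. z \<in> L i \<longrightarrow> z \<in> {a i<..<b i}"
  proof (rule AE_finite_allI [OF I(1)])
    fix i assume i: "i \<in> I"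
    have "AE z in \<sigma>. z \<notin> L i \<inter> {b i<..}" "AE z in \<sigma>. z \<notin> L i \<inter> {..<a i}" "AE z in \<sigma>. z \<notin> {a i}" "AE z in \<sigma>. z \<notin> {b i}"
      by (rule AE0; use a b i atomless in simp)+
    then show "AE z in \<sigma>. z \<in> L i \<longrightarrow> z \<in> {a i<..<b i}" by eventually_elim auto
  qed
  moreover have "AE z in \<sigma>. z \<in> \<Omega>" by (rule AE_prob_measures_on [OF P \<Omega>(3)])
  ultimately have "AE z in \<sigma>. \<forall>i\<in>I. z \<in> {a i<..<b i} \<longleftrightarrow> z \<in> \<Omega> \<and> T z = x i"
    using cover
  proof eventually_elim
    case (elim z)
    then obtain j where j: "j \<in> I" "T z = x j" "z \<in> {a j<..<b j}" by (auto simp: L_def)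
    show ?case
    proof
      fix i assume i: "i \<in> I"
      show "z \<in> {a i<..<b i} \<longleftrightarrow> z \<in> \<Omega> \<and> T z = x i"
      proof (cases "i = j")
        case True then show ?thesis using j elim by simp
      next
        case False
        have "z \<notin> {a i<..<b i}" using disjoint_family_onD [OF disj i j(1) False] j(3) by blast
        moreover have "x i \<noteq> x j" using False i j(1) I(2) by (auto simp: inj_on_def)
        ultimately show ?thesis using j(2) by simp
      qed
    qed
  qed
  with sub disj show ?thesis using that by blast
qed

section \<open>Halving the distance to a point of an interval\<close>

definition contract :: "real \<Rightarrow> real \<Rightarrow> real \<Rightarrow> real \<Rightarrow> real" where
  "contract a b \<beta> z = (if z \<in> {a<..<b} then (z + \<beta>) / 2 else z)"

lemma contract_measurable [measurable]: "contract a b \<beta> \<in> borel_measurable borel"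
  unfolding contract_def by measurable

text \<open>
  The factor \<open>2\<close> compensates the halving of lengths.  The point \<open>2 * y - \<beta>\<close> is the preimage of
  \<open>y\<close> under the contraction.
\<close>

definition contract_density :: "real \<Rightarrow> real \<Rightarrow> real \<Rightarrow> (real \<Rightarrow> real) \<Rightarrow> real \<Rightarrow> real" where
  "contract_density a b \<beta> f y =
    (if y \<in> {a<..<b} then (if 2 * y - \<beta> \<in> {a<..<b} then 2 * f (2 * y - \<beta>) else 0) else f y)"

text \<open>
  When \<open>\<beta>\<close> lies between \<open>a\<close> and \<open>b\<close>, the contraction maps the interval into itself.  Hence moved
  and unmoved mass never overlap, and the substitution \<open>z = 2 y - \<beta>\<close> gives the density piecewise.
\<close>

lemma distr_contract:
  fixes f :: "real \<Rightarrow> real"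
  assumes [measurable]: "f \<in> borel_measurable borel" and f0: "\<And>z. 0 \<le> f z" and \<beta>: "a \<le> \<beta>" "\<beta> \<le> b"
  shows "distr (density lborel (\<lambda>z. ennreal (f z))) borel (contract a b \<beta>)
    = density lborel (\<lambda>y. ennreal (contract_density a b \<beta> f y))" (is "distr ?\<sigma> _ _ = density _ (\<lambda>y. ennreal (?g y))")
proof (rule measure_eqI)
  have [measurable]: "?g \<in> borel_measurable borel" unfolding contract_density_def by measurable
  fix E assume "E \<in> sets (distr ?\<sigma> borel (contract a b \<beta>))"
  then have E [measurable]: "E \<in> sets borel" by simp
  define r where "r z = ennreal (f z) * indicator (E - {a<..<b}) z" for z
  define k where "k z = ennreal (f z) * indicator E ((z + \<beta>) / 2) * indicator {a<..<b} z" for z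
  have [measurable]: "r \<in> borel_measurable borel" "k \<in> borel_measurable borel" unfolding r_def k_def by measurable
  have "emeasure (distr ?\<sigma> borel (contract a b \<beta>)) E = (\<integral>\<^sup>+ z. indicator E (contract a b \<beta> z) \<partial>?\<sigma>)"
  proof -
    have "emeasure (distr ?\<sigma> borel (contract a b \<beta>)) E = (\<integral>\<^sup>+ y. indicator E y \<partial>distr ?\<sigma> borel (contract a b \<beta>))"
      by simp
    also have "\<dots> = (\<integral>\<^sup>+ z. indicator E (contract a b \<beta> z) \<partial>?\<sigma>)"
      by (rule nn_integral_distr) auto
    finally show ?thesis .
  qed
  also have "\<dots> = (\<integral>\<^sup>+ z. ennreal (f z) * indicator E (contract a b \<beta> z) \<partial>lborel)"
    by (simp add: nn_integral_density)
  also have "\<dots> = (\<integral>\<^sup>+ z. r z + k z \<partial>lborel)"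
    by (intro nn_integral_cong) (auto simp: contract_def r_def k_def indicator_def)
  also have "\<dots> = (\<integral>\<^sup>+ z. r z \<partial>lborel) + (\<integral>\<^sup>+ z. k z \<partial>lborel)"
    by (intro nn_integral_add) auto
  also have "(\<integral>\<^sup>+ z. k z \<partial>lborel) = (\<integral>\<^sup>+ y. 2 * k (- \<beta> + 2 * y) \<partial>lborel)"
    by (subst nn_integral_real_affine [of k 2 "- \<beta>"]) (auto simp: nn_integral_cmult)
  also have "(\<integral>\<^sup>+ z. r z \<partial>lborel) + (\<integral>\<^sup>+ y. 2 * k (- \<beta> + 2 * y) \<partial>lborel)
      = (\<integral>\<^sup>+ y. r y + 2 * k (- \<beta> + 2 * y) \<partial>lborel)"
    by (intro nn_integral_add [symmetric]) auto
  also have "\<dots> = (\<integral>\<^sup>+ y. ennreal (?g y) * indicator E y \<partial>lborel)"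
  proof (intro nn_integral_cong)
    fix y
    have "y \<in> {a<..<b}" if "2 * y - \<beta> \<in> {a<..<b}" using that \<beta> by auto
    then show "r y + 2 * k (- \<beta> + 2 * y) = ennreal (?g y) * indicator E y"
      using f0 by (auto simp: r_def k_def contract_density_def indicator_def ennreal_mult add.commute)
  qed
  also have "\<dots> = emeasure (density lborel (\<lambda>y. ennreal (?g y))) E"
    by (simp add: emeasure_density)
  finally show "emeasure (distr ?\<sigma> borel (contract a b \<beta>)) E = emeasure (density lborel (\<lambda>y. ennreal (?g y))) E" .
qed simp

text \<open>
  Compressing a mass \<open>m\<close> by the factor \<open>2\<close> doubles its density, and
  \<open>2 t ln (2 t) = 2 ln 2 t + 2 t ln t\<close>, so the entropy grows by exactly \<open>m ln 2\<close>.  This additivity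
  relies on the moved and the unmoved mass living on disjoint sets.
\<close>

lemma boltzmann_entropy_contract:
  fixes f :: "real \<Rightarrow> real" and \<Omega> :: "real set"
  assumes f [measurable]: "f \<in> borel_measurable borel" and f0: "\<And>z. 0 \<le> f z" and \<beta>: "a \<le> \<beta>" "\<beta> \<le> b"
    and \<sigma>: "\<sigma> = density lborel (\<lambda>z. ennreal (f z))" "\<sigma> \<in> prob_measures_on \<Omega>"
    and \<Omega> [measurable]: "\<Omega> \<in> sets borel" and J: "{a<..<b} \<subseteq> \<Omega>"
    and int: "integrable lborel (\<lambda>z. indicator \<Omega> z * (f z * ln (f z)))"
  shows "distr \<sigma> borel (contract a b \<beta>) \<in> prob_measures_on \<Omega>"
    and "boltzmann_entropy \<Omega> (distr \<sigma> borel (contract a b \<beta>))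
      = boltzmann_entropy \<Omega> \<sigma> + ereal (ln 2 * measure \<sigma> {a<..<b})"
proof -
  let ?S = "contract a b \<beta>" and ?g = "contract_density a b \<beta> f"
  have s [measurable_cong]: "sets \<sigma> = sets borel" and "prob_space \<sigma>" and em\<Omega>: "emeasure \<sigma> \<Omega> = 1"
    using \<sigma>(2) by (auto simp: prob_measures_on_def)
  then interpret prob_space \<sigma> by simp
  have sp: "space \<sigma> = UNIV" using sets_eq_imp_space_eq [OF s] by simp
  have ps: "prob_space (distr \<sigma> borel ?S)" by (rule prob_space_distr) measurable
  have "emeasure \<sigma> \<Omega> \<le> emeasure \<sigma> (?S -` \<Omega>)"
  proof (rule emeasure_mono)
    have "?S z \<in> \<Omega>" if "z \<in> \<Omega>" for z using that J \<beta> by (auto simp: contract_def intro!: subsetD [OF J])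
    then show "\<Omega> \<subseteq> ?S -` \<Omega>" by auto
    show "?S -` \<Omega> \<in> events" using measurable_sets_borel [OF contract_measurable \<Omega>] s by simp
  qed
  then have "emeasure (distr \<sigma> borel ?S) \<Omega> = 1"
    using em\<Omega> prob_space.emeasure_le_1 [OF ps, of \<Omega>] by (subst emeasure_distr) (auto simp: sp emeasure_distr intro: antisym)
  with ps show P: "distr \<sigma> borel ?S \<in> prob_measures_on \<Omega>" by (simp add: prob_measures_on_def)
  define \<phi> where "\<phi> t = t * ln t" for t :: real
  have \<phi>2: "\<phi> (2 * t) = 2 * ln 2 * t + 2 * \<phi> t" if "0 \<le> t" for t
    using that by (cases "t = 0") (auto simp: \<phi>_def ln_mult algebra_simps)
  have [measurable]: "\<phi> \<in> borel_measurable borel" unfolding \<phi>_def by measurable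
  have "(\<integral>\<^sup>+ z. ennreal (f z) \<partial>lborel) = emeasure \<sigma> UNIV" unfolding \<sigma>(1) by (simp add: emeasure_density)
  then have intf: "integrable lborel f"
    using f0 emeasure_space_1 sp by (intro integrableI_nonneg) auto
  have mJ: "measure \<sigma> {a<..<b} = (LINT z|lborel. indicator {a<..<b} z * f z)"
  proof -
    have "measure \<sigma> {a<..<b} = (LINT z|\<sigma>. indicator {a<..<b} z)" by (simp add: sp)
    also have "\<dots> = (LINT z|lborel. f z *\<^sub>R indicator {a<..<b} z)"
      unfolding \<sigma>(1) using f0 by (intro integral_density) auto
    finally show ?thesis by (simp add: mult.commute)
  qed
  define k where "k z = indicator {a<..<b} z * (2 * ln 2 * f z + 2 * \<phi> (f z))" for z
  have intr: "integrable lborel (\<lambda>z. indicator (\<Omega> - {a<..<b}) z * \<phi> (f z))"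
    and intJ: "integrable lborel (\<lambda>z. indicator {a<..<b} z * \<phi> (f z))"
    and intf': "integrable lborel (\<lambda>z. indicator {a<..<b} z * f z)"
  proof -
    have "(\<lambda>z. indicator (\<Omega> - {a<..<b}) z * \<phi> (f z)) = (\<lambda>z. indicator (\<Omega> - {a<..<b}) z *\<^sub>R (indicator \<Omega> z * (f z * ln (f z))))"
      "(\<lambda>z. indicator {a<..<b} z * \<phi> (f z)) = (\<lambda>z. indicator {a<..<b} z *\<^sub>R (indicator \<Omega> z * (f z * ln (f z))))"
      using J by (intro ext; auto simp: indicator_def \<phi>_def)+
    then show "integrable lborel (\<lambda>z. indicator (\<Omega> - {a<..<b}) z * \<phi> (f z))"
      "integrable lborel (\<lambda>z. indicator {a<..<b} z * \<phi> (f z))"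
      using integrable_mult_indicator [OF _ int] by simp_all
    show "integrable lborel (\<lambda>z. indicator {a<..<b} z * f z)"
      using integrable_mult_indicator [OF _ intf, of "{a<..<b}"] by simp
  qed
  have k: "k = (\<lambda>z. 2 * ln 2 * (indicator {a<..<b} z * f z) + 2 * (indicator {a<..<b} z * \<phi> (f z)))"
    by (auto simp: k_def algebra_simps)
  have intk: "integrable lborel k" unfolding k using intJ intf' by simp
  have split: "indicator \<Omega> y * \<phi> (?g y) = indicator (\<Omega> - {a<..<b}) y * \<phi> (f y) + k (- \<beta> + 2 * y)" for y
  proof -
    have "y \<in> {a<..<b}" if "2 * y - \<beta> \<in> {a<..<b}" using that \<beta> by auto
    moreover have "\<phi> 0 = 0" by (simp add: \<phi>_def)
    ultimately show ?thesis
      using J by (auto simp: contract_density_def k_def indicator_def \<phi>2 f0 algebra_simps)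
  qed
  have intk': "integrable lborel (\<lambda>y. k (- \<beta> + 2 * y))"
    using intk by (intro lborel_integrable_real_affine) auto
  have "boltzmann_entropy \<Omega> (distr \<sigma> borel ?S) = ereal (LINT y|lborel. indicator \<Omega> y * \<phi> (?g y))"
    unfolding \<phi>_def
  proof (rule boltzmann_entropy_density)
    show "distr \<sigma> borel ?S = density lborel (\<lambda>y. ennreal (?g y))"
      unfolding \<sigma>(1) by (rule distr_contract) (use f0 \<beta> in auto)
    show "?g \<in> borel_measurable borel" unfolding contract_density_def by measurable
    show "integrable lborel (\<lambda>y. indicator \<Omega> y * (?g y * ln (?g y)))"
      using split intr intk' unfolding \<phi>_def [symmetric] by simp
  qed (use P f0 in \<open>auto simp: contract_density_def\<close>)
  also have "(LINT y|lborel. indicator \<Omega> y * \<phi> (?g y))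
      = (LINT z|lborel. indicator (\<Omega> - {a<..<b}) z * \<phi> (f z)) + (LINT z|lborel. k z) / 2"
    unfolding split using intr intk' lborel_integral_real_affine [of 2 k "- \<beta>"] by simp
  also have "(LINT z|lborel. k z) / 2 = ln 2 * measure \<sigma> {a<..<b} + (LINT z|lborel. indicator {a<..<b} z * \<phi> (f z))"
    unfolding k mJ using intJ intf' by simp
  also have "(LINT z|lborel. indicator (\<Omega> - {a<..<b}) z * \<phi> (f z)) + (ln 2 * measure \<sigma> {a<..<b} + (LINT z|lborel. indicator {a<..<b} z * \<phi> (f z)))
     = (LINT z|lborel. indicator \<Omega> z * \<phi> (f z)) + ln 2 * measure \<sigma> {a<..<b}"
  proof -
    have "indicator \<Omega> z * \<phi> (f z) = indicator (\<Omega> - {a<..<b}) z * \<phi> (f z) + indicator {a<..<b} z * \<phi> (f z)" for z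
      using J by (auto simp: indicator_def)
    then show ?thesis using intr intJ by simp
  qed
  finally show "boltzmann_entropy \<Omega> (distr \<sigma> borel ?S) = boltzmann_entropy \<Omega> \<sigma> + ereal (ln 2 * measure \<sigma> {a<..<b})"
    using boltzmann_entropy_density [OF \<sigma> f \<Omega> f0 int] by (simp add: \<phi>_def)
qed

section \<open>Empirical measures and competitors of finite energy\<close>

lemma prob_space_empirical_measure:
  assumes "N \<ge> 1" shows "prob_space (empirical_measure N x)"
  unfolding empirical_measure_def
  by (intro prob_space.prob_space_distr prob_space_uniform_count_measure)
     (use assms in \<open>auto simp: measurable_def sets_uniform_count_measure space_uniform_count_measure\<close>)

lemma distr_empirical_measure:
  assumes B: "B \<in> borel_measurable borel" and eq: "\<And>i. i \<in> {1..N} \<Longrightarrow> B (x i) = y i"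
  shows "distr (empirical_measure N x) borel B = empirical_measure N y"
  unfolding empirical_measure_def
  by (subst distr_distr [OF B])
     (auto simp: measurable_def sets_uniform_count_measure space_uniform_count_measure eq intro!: distr_cong)

text \<open>
  The product coupling has bounded cost.
\<close>

lemma W2_squared_bounded_finite:
  fixes \<mu> \<nu> :: "real measure"
  assumes \<mu>: "prob_space \<mu>" "sets \<mu> = sets borel" "AE y in \<mu>. \<bar>y\<bar> \<le> K"
    and \<nu>: "prob_space \<nu>" "sets \<nu> = sets borel" "AE y in \<nu>. \<bar>y\<bar> \<le> K"
  shows "W2_squared \<mu> \<nu> < \<infinity>"
proof -
  interpret \<mu>: prob_space \<mu> by fact
  interpret \<nu>: prob_space \<nu> by fact
  interpret pair_prob_space \<mu> \<nu> ..
  note [measurable_cong] = \<mu>(2) \<nu>(2)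
  have 1: "distr (\<mu> \<Otimes>\<^sub>M \<nu>) borel fst = \<mu>"
    using \<nu>.distr_pair_fst [of \<mu>] \<mu>(2) by (simp cong: distr_cong)
  have 2: "distr (\<mu> \<Otimes>\<^sub>M \<nu>) borel snd = \<nu>"
  proof (rule measure_eqI)
    fix A assume "A \<in> sets (distr (\<mu> \<Otimes>\<^sub>M \<nu>) borel snd)"
    then have [measurable]: "A \<in> sets \<nu>" using \<nu>(2) by simp
    have "snd -` A \<inter> space (\<mu> \<Otimes>\<^sub>M \<nu>) = space \<mu> \<times> A"
      using sets.sets_into_space [of A \<nu>] by (auto simp: space_pair_measure)
    then show "emeasure (distr (\<mu> \<Otimes>\<^sub>M \<nu>) borel snd) A = emeasure \<nu> A"
      using \<nu>(2) by (subst emeasure_distr) (auto simp: \<nu>.emeasure_pair_measure_Times \<mu>.emeasure_space_1)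
  qed (simp add: \<nu>)
  have "AE z in \<mu> \<Otimes>\<^sub>M \<nu>. \<bar>fst z\<bar> \<le> K"
    using \<mu>(3) by (subst (asm) 1 [symmetric]) (simp add: AE_distr_iff)
  moreover have "AE z in \<mu> \<Otimes>\<^sub>M \<nu>. \<bar>snd z\<bar> \<le> K"
    using \<nu>(3) by (subst (asm) 2 [symmetric]) (simp add: AE_distr_iff)
  ultimately have bd: "AE z in \<mu> \<Otimes>\<^sub>M \<nu>. ennreal ((dist (fst z) (snd z))\<^sup>2) \<le> ennreal ((2 * K)\<^sup>2)"
  proof eventually_elim
    case (elim z)
    then have "\<bar>fst z - snd z\<bar> \<le> \<bar>2 * K\<bar>" by linarith
    then show ?case unfolding dist_real_def abs_le_square_iff by (intro ennreal_leI) simp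
  qed
  have "W2_squared \<mu> \<nu> \<le> (\<integral>\<^sup>+ z. ennreal ((dist (fst z) (snd z))\<^sup>2) \<partial>(\<mu> \<Otimes>\<^sub>M \<nu>))"
    using W2_squared_le_maps [of fst "\<mu> \<Otimes>\<^sub>M \<nu>" snd] by (simp add: 1 2)
  also have "\<dots> \<le> (\<integral>\<^sup>+ z. ennreal ((2 * K)\<^sup>2) \<partial>(\<mu> \<Otimes>\<^sub>M \<nu>))" using bd by (rule nn_integral_mono_AE)
  also have "\<dots> < \<infinity>" by (simp add: emeasure_space_1)
  finally show ?thesis .
qed

text \<open>
  The uniform distribution.  Comparison with it shows that a minimizer has finite entropy, hence a
  density.
\<close>

lemma finite_regularized_functional_exists:
  fixes \<Omega> :: "real set"
  assumes \<Omega> [measurable]: "\<Omega> \<in> sets borel" and bnd: "bounded \<Omega>" and pos: "0 < measure lborel \<Omega>"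
    and \<mu>: "prob_space \<mu>" "sets \<mu> = sets borel" "AE y in \<mu>. \<bar>y\<bar> \<le> K"
  obtains \<rho> where "\<rho> \<in> prob_measures_on \<Omega>" "regularized_functional \<Omega> \<epsilon> \<mu> \<rho> < \<infinity>"
proof -
  obtain K' where K': "\<And>z. z \<in> \<Omega> \<Longrightarrow> \<bar>z\<bar> \<le> K'" using bnd by (auto simp: bounded_iff)
  define l where "l = measure lborel \<Omega>"
  have l: "emeasure lborel \<Omega> = ennreal l" unfolding l_def
    using emeasure_bounded_finite [OF bnd] by (intro emeasure_eq_ennreal_measure) auto
  have "0 < l" using pos by (simp add: l_def)
  define f where "f z = indicator \<Omega> z / l" for z
  define \<rho> where "\<rho> = uniform_measure lborel \<Omega>"
  have \<rho>: "\<rho> = density lborel (\<lambda>z. ennreal (f z))"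
    unfolding \<rho>_def uniform_measure_def l using \<open>0 < l\<close> divide_ennreal [of 1 l]
    by (intro density_cong) (auto simp: f_def indicator_def)
  have ps: "prob_space \<rho>" unfolding \<rho>_def using \<open>0 < l\<close> by (intro prob_space_uniform_measure) (auto simp: l)
  have "emeasure \<rho> \<Omega> = 1" unfolding \<rho>_def using \<open>0 < l\<close> by (intro emeasure_uniform_measure_1) (auto simp: l)
  with ps have P: "\<rho> \<in> prob_measures_on \<Omega>" by (simp add: prob_measures_on_def \<rho>_def)
  have "boltzmann_entropy \<Omega> \<rho> = ereal (LINT z|lborel. indicator \<Omega> z * (f z * ln (f z)))"
  proof (rule boltzmann_entropy_density [OF \<rho> P])
    have "(\<lambda>z. indicator \<Omega> z * (f z * ln (f z))) = (\<lambda>z. (1 / l * ln (1 / l)) * indicator \<Omega> z)"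
      by (auto simp: f_def indicator_def)
    then show "integrable lborel (\<lambda>z. indicator \<Omega> z * (f z * ln (f z)))" by (simp add: l)
  qed (use \<open>0 < l\<close> in \<open>auto simp: f_def [abs_def]\<close>)
  moreover have "W2_squared \<mu> \<rho> < \<infinity>"
  proof (rule W2_squared_bounded_finite [OF \<mu>(1,2) _ ps])
    show "AE y in \<mu>. \<bar>y\<bar> \<le> max K K'" using \<mu>(3) by eventually_elim auto
    show "AE y in \<rho>. \<bar>y\<bar> \<le> max K K'" unfolding \<rho>_def using K' by (intro AE_uniform_measureI) (auto simp: le_max_iff_disj)
  qed (simp add: \<rho>_def)
  ultimately have "regularized_functional \<Omega> \<epsilon> \<mu> \<rho> < \<infinity>"
    unfolding regularized_functional_def by (cases "W2_squared \<mu> \<rho>") (auto simp: enn2ereal_ennreal)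
  with P show ?thesis by (rule that)
qed

section \<open>Summing over the cells\<close>

lemma sum_disjoint_interval_lengths_le:
  fixes a b :: "'i \<Rightarrow> real"
  assumes "finite I" and ab: "\<And>i. i \<in> I \<Longrightarrow> a i \<le> b i" and sub: "\<And>i. i \<in> I \<Longrightarrow> {a i<..<b i} \<subseteq> \<Omega>"
    and disj: "disjoint_family_on (\<lambda>i. {a i<..<b i}) I" and "bounded \<Omega>" "\<Omega> \<in> sets borel"
  shows "(\<Sum>i\<in>I. b i - a i) \<le> measure lborel \<Omega>"
proof -
  have "(\<Sum>i\<in>I. b i - a i) = (\<Sum>i\<in>I. measure lborel {a i<..<b i})" using ab by (intro sum.cong) auto
  also have "\<dots> = measure lborel (\<Union>i\<in>I. {a i<..<b i})"
    using \<open>finite I\<close> disj ab by (intro measure_finite_Union [symmetric]) auto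
  also have "\<dots> \<le> measure lborel \<Omega>"
    using assms emeasure_bounded_finite [of \<Omega>] by (intro measure_mono_fmeasurable) (auto simp: fmeasurable_def)
  finally show ?thesis .
qed

text \<open>
  On a set of length zero every measure has infinite entropy and minimality carries no information;
  for such an interval the quantization estimate is read off directly.
\<close>

lemma null_interval_singleton:
  fixes \<Omega> :: "real set"
  assumes "is_interval \<Omega>" "bounded \<Omega>" "\<Omega> \<in> sets borel" "measure lborel \<Omega> = 0" "\<Omega> \<noteq> {}"
  obtains p where "\<Omega> = {p}"
proof -
  obtain p where p: "p \<in> \<Omega>" using assms(5) by auto
  have "\<not> u < v" if uv: "u \<in> \<Omega>" "v \<in> \<Omega>" for u v
  proof
    assume "u < v"
    have "{u..v} \<subseteq> \<Omega>" using mem_is_interval_1_I [OF assms(1) uv] by auto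
    then have "measure lborel {u..v} \<le> measure lborel \<Omega>"
      using assms emeasure_bounded_finite [of \<Omega>] by (intro measure_mono_fmeasurable) (auto simp: fmeasurable_def)
    with \<open>u < v\<close> assms(4) show False by simp
  qed
  then have "z = p" if "z \<in> \<Omega>" for z using p that by (meson linorder_less_linear)
  with p have "\<Omega> = {p}" by blast
  then show ?thesis by (rule that)
qed

text \<open>
  Sending each cell to its own point \<open>\<beta> i\<close> is an admissible transport.
\<close>

lemma W2_squared_cells_le:
  fixes \<sigma> :: "real measure" and x \<beta> :: "nat \<Rightarrow> real" and T :: "real \<Rightarrow> real"
  assumes P: "\<sigma> \<in> prob_measures_on \<Omega>" and \<Omega> [measurable]: "\<Omega> \<in> sets borel" and bnd: "bounded \<Omega>"
    and inj: "inj_on x {1..N}"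
    and T [measurable]: "T \<in> borel_measurable borel" and \<mu>: "distr \<sigma> borel T = empirical_measure N x"
    and cover: "AE z in \<sigma>. T z \<in> x ` {1..N}"
  shows "W2_squared \<sigma> (empirical_measure N \<beta>)
    \<le> ennreal (\<Sum>i=1..N. LINT z|\<sigma>. indicator {z \<in> \<Omega>. T z = x i} z * (z - \<beta> i)\<^sup>2)"
proof -
  have s [measurable_cong]: "sets \<sigma> = sets borel" and "prob_space \<sigma>"
    using P by (auto simp: prob_measures_on_def)
  then interpret prob_space \<sigma> by simp
  obtain K where K: "\<And>z. z \<in> \<Omega> \<Longrightarrow> \<bar>z\<bar> \<le> K" using bnd by (auto simp: bounded_iff)
  have AE\<Omega>: "AE z in \<sigma>. z \<in> \<Omega>" by (rule AE_prob_measures_on [OF P \<Omega>])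
  define B where "B y = (\<Sum>i=1..N. \<beta> i * indicator {x i} y)" for y
  have [measurable]: "B \<in> borel_measurable borel" unfolding B_def by measurable
  have B: "B (x i) = \<beta> i" if "i \<in> {1..N}" for i
  proof -
    have "B (x i) = (\<Sum>j=1..N. if j = i then \<beta> j else 0)"
      unfolding B_def using that by (intro sum.cong) (auto simp: indicator_def inj_on_eq_iff [OF inj])
    then show ?thesis using that by simp
  qed
  have d: "distr \<sigma> borel (\<lambda>z. B (T z)) = empirical_measure N \<beta>"
  proof -
    have "distr \<sigma> borel (\<lambda>z. B (T z)) = distr (distr \<sigma> borel T) borel B"
      by (subst distr_distr) (auto simp: o_def)
    also have "\<dots> = empirical_measure N \<beta>"
      unfolding \<mu> by (rule distr_empirical_measure) (use B in auto)
    finally show ?thesis .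
  qed
  have "distr \<sigma> borel (\<lambda>z. z) = \<sigma>" using s by (intro distr_id2) simp
  with W2_squared_le_maps [of "\<lambda>z. z" \<sigma> "\<lambda>z. B (T z)"]
  have "W2_squared \<sigma> (empirical_measure N \<beta>) \<le> (\<integral>\<^sup>+ z. ennreal ((z - B (T z))\<^sup>2) \<partial>\<sigma>)"
    by (simp add: d dist_real_def)
  also have "\<dots> = (\<integral>\<^sup>+ z. ennreal (\<Sum>i=1..N. indicator {z \<in> \<Omega>. T z = x i} z * (z - \<beta> i)\<^sup>2) \<partial>\<sigma>)"
  proof (rule nn_integral_cong_AE)
    show "AE z in \<sigma>. ennreal ((z - B (T z))\<^sup>2) = ennreal (\<Sum>i=1..N. indicator {z \<in> \<Omega>. T z = x i} z * (z - \<beta> i)\<^sup>2)"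
      using AE\<Omega> cover
    proof eventually_elim
      case (elim z)
      then obtain j where j: "j \<in> {1..N}" "T z = x j" by auto
      have "(\<Sum>i=1..N. indicator {z \<in> \<Omega>. T z = x i} z * (z - \<beta> i)\<^sup>2) = (\<Sum>i=1..N. if i = j then (z - \<beta> i)\<^sup>2 else 0)"
        using j elim by (intro sum.cong) (auto simp: indicator_def inj_on_eq_iff [OF inj])
      also have "\<dots> = (z - B (T z))\<^sup>2" using j B by simp
      finally show ?case by simp
    qed
  qed
  also have "\<dots> = ennreal (\<Sum>i=1..N. LINT z|\<sigma>. indicator {z \<in> \<Omega>. T z = x i} z * (z - \<beta> i)\<^sup>2)"
  proof -
    have int: "integrable \<sigma> (\<lambda>z. indicator {z \<in> \<Omega>. T z = x i} z * (z - \<beta> i)\<^sup>2)" for i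
    proof (rule integrable_const_bound [where B = "(K + \<bar>\<beta> i\<bar>)\<^sup>2"])
      have "(z - \<beta> i)\<^sup>2 \<le> (K + \<bar>\<beta> i\<bar>)\<^sup>2" if "z \<in> \<Omega>" for z
        using K [OF that] by (subst abs_le_square_iff [symmetric]) auto
      then show "AE z in \<sigma>. norm (indicator {z \<in> \<Omega>. T z = x i} z * (z - \<beta> i)\<^sup>2) \<le> (K + \<bar>\<beta> i\<bar>)\<^sup>2"
        by (intro AE_I2) (auto simp: indicator_def)
    qed measurable
    have "(\<integral>\<^sup>+ z. ennreal (\<Sum>i=1..N. indicator {z \<in> \<Omega>. T z = x i} z * (z - \<beta> i)\<^sup>2) \<partial>\<sigma>)
        = ennreal (LINT z|\<sigma>. (\<Sum>i=1..N. indicator {z \<in> \<Omega>. T z = x i} z * (z - \<beta> i)\<^sup>2))"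
      by (intro nn_integral_eq_integral Bochner_Integration.integrable_sum int AE_I2 sum_nonneg) simp
    also have "(LINT z|\<sigma>. (\<Sum>i=1..N. indicator {z \<in> \<Omega>. T z = x i} z * (z - \<beta> i)\<^sup>2))
        = (\<Sum>i=1..N. LINT z|\<sigma>. indicator {z \<in> \<Omega>. T z = x i} z * (z - \<beta> i)\<^sup>2)"
      by (intro Bochner_Integration.integral_sum int)
    finally show ?thesis .
  qed
  finally show ?thesis .
qed

section \<open>Variance of a cell\<close>

text \<open>
  The competitor is the image of \<open>\<sigma>\<close> under the contraction of one cell towards its barycenter,
  where every moved point keeps its target \<open>p\<close>.  With \<open>u = z - \<beta>\<close> and \<open>d = \<beta> - p\<close> the cost decreases
  pointwise by \<open>(u + d)\<^sup>2 - (u / 2 + d)\<^sup>2 = 3/4 u\<^sup>2 + d u\<close>, and the linear term integrates to zero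
  because \<open>\<beta>\<close> is the barycenter.  Minimality compares this gain, divided by \<open>2 \<epsilon>\<close>, with the entropy
  increase \<open>m ln 2\<close>.  The constant \<open>4\<close> is a bound for \<open>8/3 ln 2\<close> that has a simple square root.
\<close>

lemma minimizer_variance_bound:
  fixes \<Omega> :: "real set" and \<sigma> \<mu> :: "real measure" and T :: "real \<Rightarrow> real"
  assumes \<Omega> [measurable]: "\<Omega> \<in> sets borel" and bnd: "bounded \<Omega>" and \<epsilon>: "0 < \<epsilon>"
    and P: "\<sigma> \<in> prob_measures_on \<Omega>"
    and min: "\<And>\<rho>. \<rho> \<in> prob_measures_on \<Omega> \<Longrightarrow> regularized_functional \<Omega> \<epsilon> \<mu> \<sigma> \<le> regularized_functional \<Omega> \<epsilon> \<mu> \<rho>"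
    and fin: "boltzmann_entropy \<Omega> \<sigma> < \<infinity>"
    and T: "optimal_transport_map \<sigma> \<mu> T"
    and int: "integrable \<sigma> (\<lambda>z. (z - T z)\<^sup>2)"
    and J: "{a<..<b} \<subseteq> \<Omega>" and Tp: "AE z in \<sigma>. z \<in> {a<..<b} \<longrightarrow> T z = p"
    and \<beta>: "a \<le> \<beta>" "\<beta> \<le> b"
    and bary: "(LINT z|\<sigma>. indicator {a<..<b} z * z) = \<beta> * measure \<sigma> {a<..<b}"
  shows "(LINT z|\<sigma>. indicator {a<..<b} z * (z - \<beta>)\<^sup>2) \<le> 4 * \<epsilon> * measure \<sigma> {a<..<b}"
proof -
  let ?J = "{a<..<b}" and ?S = "contract a b \<beta>"
  have s [measurable_cong]: "sets \<sigma> = sets borel" and "prob_space \<sigma>" using P by (auto simp: prob_measures_on_def)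
  then interpret prob_space \<sigma> by simp
  have [measurable]: "T \<in> borel_measurable borel" and \<mu>: "distr \<sigma> borel T = \<mu>"
    and opt: "(\<integral>\<^sup>+ z. ennreal ((dist z (T z))\<^sup>2) \<partial>\<sigma>) = W2_squared \<sigma> \<mu>"
    using T s by (auto simp: optimal_transport_map_def cong: measurable_cong_sets)
  define V where "V = (LINT z|\<sigma>. indicator ?J z * (z - \<beta>)\<^sup>2)"
  define m where "m = measure \<sigma> ?J"
  obtain f where f: "f \<in> borel_measurable borel" "\<And>x. 0 \<le> f x" "\<sigma> = density lborel (\<lambda>x. ennreal (f x))"
      "integrable lborel (\<lambda>x. indicator \<Omega> x * (f x * ln (f x)))"
    using finite_entropy_density [OF fin \<Omega> bnd] by blast
  note contr = boltzmann_entropy_contract [OF f(1,2) \<beta> f(3) P \<Omega> J f(4)]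
  obtain h where h: "boltzmann_entropy \<Omega> \<sigma> = ereal h"
    using boltzmann_entropy_density [OF f(3) P f(1) \<Omega> f(2) f(4)] by blast
  have intb: "integrable \<sigma> (\<lambda>z. indicator ?J z * g z)"
    if "g \<in> borel_measurable borel" and "\<And>z. z \<in> ?J \<Longrightarrow> \<bar>g z\<bar> \<le> K" for g :: "real \<Rightarrow> real" and K
    using that by (intro integrable_indicator_times_bounded) (auto cong: measurable_cong_sets)
  have dJ: "\<bar>z - \<beta>\<bar> \<le> b - a" if "z \<in> ?J" for z using that \<beta> by auto
  have int2: "integrable \<sigma> (\<lambda>z. indicator ?J z * (z - \<beta>)\<^sup>2)"
    by (rule intb [of _ "(b - a)\<^sup>2"]) (use dJ in \<open>auto simp: abs_le_square_iff [symmetric]\<close>)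
  have int1: "integrable \<sigma> (\<lambda>z. indicator ?J z * (z - \<beta>))"
    by (rule intb [of _ "b - a"]) (use dJ in auto)
  have int1': "integrable \<sigma> (\<lambda>z. indicator ?J z * z)"
    by (rule intb [of _ "\<bar>a\<bar> + \<bar>b\<bar>"]) auto
  have zero: "(LINT z|\<sigma>. indicator ?J z * (z - \<beta>)) = 0"
  proof -
    have "(LINT z|\<sigma>. indicator ?J z * (z - \<beta>)) = (LINT z|\<sigma>. indicator ?J z * z - \<beta> * indicator ?J z)"
      by (intro Bochner_Integration.integral_cong) (auto simp: algebra_simps)
    also have "\<dots> = 0" using int1' bary by (simp add: emeasure_eq_measure sets_eq_imp_space_eq [OF s])
    finally show ?thesis .
  qed
  \<comment> \<open>The pointwise decrease of the transport cost.\<close>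
  define D where "D z = 3/4 * (indicator ?J z * (z - \<beta>)\<^sup>2) + (\<beta> - p) * (indicator ?J z * (z - \<beta>))" for z
  have [measurable]: "D \<in> borel_measurable borel" unfolding D_def by measurable
  have intD: "integrable \<sigma> D" and D: "(LINT z|\<sigma>. D z) = 3/4 * V"
    unfolding D_def V_def using int1 int2 zero by simp_all
  have eq: "AE z in \<sigma>. (?S z - T z)\<^sup>2 = (z - T z)\<^sup>2 - D z"
    using Tp by eventually_elim (auto simp: D_def contract_def indicator_def power2_eq_square field_simps)
  have "W2_squared \<mu> (distr \<sigma> borel ?S) \<le> (\<integral>\<^sup>+ z. ennreal ((T z - ?S z)\<^sup>2) \<partial>\<sigma>)"
    using W2_squared_le_maps [of T \<sigma> ?S] by (simp add: \<mu> dist_real_def)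
  also have "\<dots> = (\<integral>\<^sup>+ z. ennreal ((z - T z)\<^sup>2 - D z) \<partial>\<sigma>)"
    using eq by (intro nn_integral_cong_AE) (auto elim!: eventually_mono simp: power2_commute)
  also have "\<dots> = ennreal (LINT z|\<sigma>. (z - T z)\<^sup>2 - D z)"
  proof (rule nn_integral_eq_integral)
    show "AE z in \<sigma>. 0 \<le> (z - T z)\<^sup>2 - D z"
      using eq by eventually_elim (metis zero_le_power2)
  qed (use int intD in simp)
  also have "(LINT z|\<sigma>. (z - T z)\<^sup>2 - D z) = (LINT z|\<sigma>. (z - T z)\<^sup>2) - 3/4 * V"
    using int intD D by simp
  finally have W': "W2_squared \<mu> (distr \<sigma> borel ?S) \<le> ennreal ((LINT z|\<sigma>. (z - T z)\<^sup>2) - 3/4 * V)" .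
  have "0 \<le> (LINT z|\<sigma>. (?S z - T z)\<^sup>2)" by simp
  also have "\<dots> = (LINT z|\<sigma>. (z - T z)\<^sup>2 - D z)"
    using eq by (intro integral_cong_AE) auto
  also have "\<dots> = (LINT z|\<sigma>. (z - T z)\<^sup>2) - 3/4 * V" using int intD D by simp
  finally have nn: "0 \<le> (LINT z|\<sigma>. (z - T z)\<^sup>2) - 3/4 * V" .
  have W: "W2_squared \<mu> \<sigma> = ennreal (LINT z|\<sigma>. (z - T z)\<^sup>2)"
    using opt int by (simp add: W2_squared_commute [of \<mu>] dist_real_def nn_integral_eq_integral)
  have "ereal (1 / (2 * \<epsilon>)) * ereal (LINT z|\<sigma>. (z - T z)\<^sup>2) + ereal h
      = regularized_functional \<Omega> \<epsilon> \<mu> \<sigma>"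
    by (simp add: regularized_functional_def W h enn2ereal_ennreal)
  also have "\<dots> \<le> regularized_functional \<Omega> \<epsilon> \<mu> (distr \<sigma> borel ?S)"
    by (rule min [OF contr(1)])
  also have "\<dots> \<le> ereal (1 / (2 * \<epsilon>)) * ereal ((LINT z|\<sigma>. (z - T z)\<^sup>2) - 3/4 * V) + ereal (h + ln 2 * m)"
  proof -
    have "enn2ereal (W2_squared \<mu> (distr \<sigma> borel ?S)) \<le> ereal ((LINT z|\<sigma>. (z - T z)\<^sup>2) - 3/4 * V)"
      using W' nn by (simp add: less_eq_ennreal.rep_eq enn2ereal_ennreal)
    then show ?thesis unfolding regularized_functional_def contr(2) h m_def
      using \<epsilon> by (intro add_mono ereal_mult_left_mono) auto
  qed
  finally have "(LINT z|\<sigma>. (z - T z)\<^sup>2) / (2 * \<epsilon>)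
      \<le> ((LINT z|\<sigma>. (z - T z)\<^sup>2) - 3/4 * V) / (2 * \<epsilon>) + ln 2 * m"
    by simp
  then have "(3/4 * V) / (2 * \<epsilon>) \<le> ln 2 * m"
    by (simp add: diff_divide_distrib)
  also have "\<dots> \<le> 1 * m" using ln_2_less_1 by (intro mult_right_mono) (auto simp: m_def)
  finally have "3/4 * V \<le> 2 * \<epsilon> * m" using \<epsilon> by (simp add: field_simps)
  moreover have "0 \<le> \<epsilon> * m" using \<epsilon> by (simp add: m_def)
  ultimately show ?thesis by (simp add: V_def [symmetric] m_def [symmetric])
qed

text \<open>
  The geometric mean of two bounds on the unnormalized variance: \<open>4 \<epsilon> m\<close> from minimality, and
  \<open>(b - a)\<^sup>2 m\<close> from the length of the cell.  The mean is linear in the length, which is what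
  allows summation over disjoint cells.
\<close>

lemma cell_variance_le:
  fixes \<Omega> :: "real set" and \<sigma> \<mu> :: "real measure" and T :: "real \<Rightarrow> real"
  assumes \<Omega> [measurable]: "\<Omega> \<in> sets borel" and bnd: "bounded \<Omega>" and \<epsilon>: "0 < \<epsilon>"
    and P: "\<sigma> \<in> prob_measures_on \<Omega>"
    and min: "\<And>\<rho>. \<rho> \<in> prob_measures_on \<Omega> \<Longrightarrow> regularized_functional \<Omega> \<epsilon> \<mu> \<sigma> \<le> regularized_functional \<Omega> \<epsilon> \<mu> \<rho>"
    and fin: "boltzmann_entropy \<Omega> \<sigma> < \<infinity>"
    and T: "optimal_transport_map \<sigma> \<mu> T"
    and int: "integrable \<sigma> (\<lambda>z. (z - T z)\<^sup>2)"
    and J: "{a<..<b} \<subseteq> \<Omega>" and Tp: "AE z in \<sigma>. z \<in> {a<..<b} \<longrightarrow> T z = p"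
    and m: "m = measure \<sigma> {a<..<b}" "0 < m"
    and \<beta>: "\<beta> = (LINT z|\<sigma>. indicator {a<..<b} z * z) / m"
  shows "(LINT z|\<sigma>. indicator {a<..<b} z * (z - \<beta>)\<^sup>2) \<le> 2 * sqrt \<epsilon> * m * (b - a)"
proof -
  let ?J = "{a<..<b}"
  have s [measurable_cong]: "sets \<sigma> = sets borel" and "prob_space \<sigma>" using P by (auto simp: prob_measures_on_def)
  then interpret prob_space \<sigma> by simp
  have sp: "space \<sigma> = UNIV" using sets_eq_imp_space_eq [OF s] by simp
  define V where "V = (LINT z|\<sigma>. indicator ?J z * (z - \<beta>)\<^sup>2)"
  have ab: "a < b" using m by (cases "a < b") auto
  have intb: "integrable \<sigma> (\<lambda>z. indicator ?J z * g z)"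
    if "g \<in> borel_measurable borel" and "\<And>z. z \<in> ?J \<Longrightarrow> \<bar>g z\<bar> \<le> K" for g :: "real \<Rightarrow> real" and K
    using that by (intro integrable_indicator_times_bounded) (auto cong: measurable_cong_sets)
  have mono: "(LINT z|\<sigma>. indicator ?J z * g z) \<le> K * m"
    if "integrable \<sigma> (\<lambda>z. indicator ?J z * g z)" and "\<And>z. z \<in> ?J \<Longrightarrow> g z \<le> K" for g :: "real \<Rightarrow> real" and K :: real
  proof -
    have "(LINT z|\<sigma>. indicator ?J z * g z) \<le> (LINT z|\<sigma>. K * indicator ?J z)"
    proof (rule integral_mono [OF that(1)])
      show "integrable \<sigma> (\<lambda>z. K * indicator ?J z)" by (simp add: emeasure_eq_measure)
      show "indicator ?J z * g z \<le> K * indicator ?J z" for z using that(2) [of z] by (simp add: indicator_def)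
    qed
    then show ?thesis by (simp add: m sp)
  qed
  have int1: "integrable \<sigma> (\<lambda>z. indicator ?J z * z)"
    by (rule intb [of _ "\<bar>a\<bar> + \<bar>b\<bar>"]) auto
  have "(LINT z|\<sigma>. indicator ?J z * z) \<le> b * m" by (rule mono [OF int1]) auto
  moreover have "(LINT z|\<sigma>. indicator ?J z * (- z)) \<le> - a * m" by (rule mono) (use int1 in auto)
  ultimately have \<beta>ab: "a \<le> \<beta>" "\<beta> \<le> b" using m(2) by (auto simp: \<beta> field_simps)
  have sq: "(z - \<beta>)\<^sup>2 \<le> (b - a)\<^sup>2" if "z \<in> ?J" for z
    using that \<beta>ab by (subst abs_le_square_iff [symmetric]) auto
  have "V \<le> 4 * \<epsilon> * m"
    unfolding V_def m(1) by (rule minimizer_variance_bound [OF \<Omega> bnd \<epsilon> P min fin T int J Tp \<beta>ab])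
      (use m in \<open>auto simp: \<beta>\<close>)
  moreover have "V \<le> (b - a)\<^sup>2 * m"
    unfolding V_def by (intro mono intb [of _ "(b - a)\<^sup>2"]) (use sq in auto)
  moreover have "0 \<le> V" unfolding V_def by simp
  ultimately have "V * V \<le> (4 * \<epsilon> * m) * ((b - a)\<^sup>2 * m)" using \<epsilon> m(2) by (intro mult_mono) auto
  also have "\<dots> = (2 * sqrt \<epsilon> * m * (b - a))\<^sup>2" using \<epsilon> by (simp add: power_mult_distrib power2_eq_square)
  finally have "V\<^sup>2 \<le> (2 * sqrt \<epsilon> * m * (b - a))\<^sup>2" by (simp add: power2_eq_square)
  then show ?thesis unfolding V_def [symmetric] by (rule power2_le_imp_le) (use \<epsilon> m ab in auto)
qed

section \<open>The quantization estimate\<close>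

theorem proposition4p2:
  shows "\<exists>C :: real \<Rightarrow> real.
    \<forall>(\<Omega> :: real set) (N :: nat) (x :: nat \<Rightarrow> real) (\<epsilon> :: real) (\<sigma> :: real measure)
      (T :: real \<Rightarrow> real) (L :: nat \<Rightarrow> real set) (\<beta> :: nat \<Rightarrow> real).
      is_interval \<Omega> \<and> bounded \<Omega> \<and> N \<ge> 1 \<and> inj_on x {1..N} \<and> \<epsilon> > 0 \<and>
      is_arg_min (regularized_functional \<Omega> \<epsilon> (empirical_measure N x))
        (\<lambda>\<rho>. \<rho> \<in> prob_measures_on \<Omega>) \<sigma> \<and>
      optimal_transport_map \<sigma> (empirical_measure N x) T \<and>
      (\<forall>i\<in>{1..N}. L i = laguerre_cell \<Omega> T (x i)) \<and>
      (\<forall>i\<in>{1..N}. \<beta> i = cell_barycenter N \<sigma> (L i))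
      \<longrightarrow> W2_squared \<sigma> (empirical_measure N \<beta>)
          \<le> ennreal (C (measure lborel \<Omega>) * (sqrt \<epsilon> / real N))"
proof (intro exI [of _ "\<lambda>l. 2 * l"] allI impI, elim conjE)
  fix \<Omega> :: "real set" and N :: nat and x :: "nat \<Rightarrow> real" and \<epsilon> :: real and \<sigma> :: "real measure"
    and T :: "real \<Rightarrow> real" and L :: "nat \<Rightarrow> real set" and \<beta> :: "nat \<Rightarrow> real"
  assume \<Omega>: "is_interval \<Omega>" "bounded \<Omega>" and N: "N \<ge> 1" and inj: "inj_on x {1..N}" and \<epsilon>: "\<epsilon> > 0"
    and argmin: "is_arg_min (regularized_functional \<Omega> \<epsilon> (empirical_measure N x)) (\<lambda>\<rho>. \<rho> \<in> prob_measures_on \<Omega>) \<sigma>"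
    and opt: "optimal_transport_map \<sigma> (empirical_measure N x) T"
    and L': "\<forall>i\<in>{1..N}. L i = laguerre_cell \<Omega> T (x i)"
    and \<beta>': "\<forall>i\<in>{1..N}. \<beta> i = cell_barycenter N \<sigma> (L i)"
  let ?\<mu> = "empirical_measure N x" and ?I = "{1..N}"
  define A where "A i = {z \<in> \<Omega>. T z = x i}" for i
  define V where "V i = (LINT z|\<sigma>. indicator (A i) z * (z - \<beta> i)\<^sup>2)" for i
  have \<Omega>b [measurable]: "\<Omega> \<in> sets borel" using \<Omega>(1) by (rule real_interval_borel_measurable)
  have P: "\<sigma> \<in> prob_measures_on \<Omega>"
    and min: "\<And>\<rho>. \<rho> \<in> prob_measures_on \<Omega> \<Longrightarrow> regularized_functional \<Omega> \<epsilon> ?\<mu> \<sigma> \<le> regularized_functional \<Omega> \<epsilon> ?\<mu> \<rho>"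
    using argmin by (auto simp: is_arg_min_def not_less)
  have s [measurable_cong]: "sets \<sigma> = sets borel" and "prob_space \<sigma>" and em\<Omega>: "emeasure \<sigma> \<Omega> = 1"
    using P by (auto simp: prob_measures_on_def)
  then interpret prob_space \<sigma> by simp
  have sp: "space \<sigma> = UNIV" using sets_eq_imp_space_eq [OF s] by simp
  have T [measurable]: "T \<in> borel_measurable borel" and \<mu>: "distr \<sigma> borel T = ?\<mu>"
    using opt s by (auto simp: optimal_transport_map_def cong: measurable_cong_sets)
  have A [measurable]: "A i \<in> sets borel" for i unfolding A_def by measurable
  have \<beta>: "\<beta> i = real N * (LINT z|\<sigma>. indicator (A i) z * z)" if "i \<in> ?I" for i
    using \<beta>' L' that by (simp add: cell_barycenter_def laguerre_cell_def A_def set_lebesgue_integral_def)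
  have AE\<Omega>: "AE z in \<sigma>. z \<in> \<Omega>" by (rule AE_prob_measures_on [OF P \<Omega>b])
  have "finite (x ` ?I)" by simp
  then have xI [measurable]: "x ` ?I \<in> sets borel" by (intro borel_closed finite_imp_closed)
  have cover\<mu>: "AE y in ?\<mu>. y \<in> x ` ?I"
  proof -
    have "emeasure ?\<mu> (x ` ?I) = 1" using N xI by (subst emeasure_empirical_measure) (auto simp: indicator_def)
    then show ?thesis using prob_space.AE_in_set_eq_1 [OF prob_space_empirical_measure [OF N, of x], of "x ` ?I"] xI
      by (simp add: measure_def empirical_measure_def)
  qed
  then have cover: "AE z in \<sigma>. T z \<in> x ` ?I"
    using xI unfolding \<mu> [symmetric] by (simp add: AE_distr_iff)
  define K where "K = (\<Sum>i\<in>?I. \<bar>x i\<bar>)"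
  have K: "\<bar>y\<bar> \<le> K" if "y \<in> x ` ?I" for y
    using that unfolding K_def by (auto intro!: member_le_sum)
  have mA: "measure \<sigma> (A i) = 1 / N" if i: "i \<in> ?I" for i
  proof -
    have "measure \<sigma> (A i) = measure \<sigma> (T -` {x i})"
    proof (rule measure_eq_AE)
      show "AE z in \<sigma>. z \<in> A i \<longleftrightarrow> z \<in> T -` {x i}" using AE\<Omega> by eventually_elim (simp add: A_def)
      show "T -` {x i} \<in> events" using measurable_sets_borel [OF T, of "{x i}"] by (simp add: s)
    qed (simp add: s)
    also have "\<dots> = measure ?\<mu> {x i}" unfolding \<mu> [symmetric] by (subst measure_distr) (auto simp: sp)
    also have "\<dots> = 1 / N * (\<Sum>j\<in>?I. indicator {x i} (x j))"
      unfolding measure_def using N by (subst emeasure_empirical_measure) (auto intro!: enn2real_ennreal divide_nonneg_nonneg sum_nonneg)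
    also have "(\<Sum>j\<in>?I. indicator {x i} (x j)) = (\<Sum>j\<in>?I. if j = i then 1 else 0 :: real)"
      using i by (intro sum.cong) (auto simp: indicator_def inj_on_eq_iff [OF inj])
    finally show ?thesis using i by simp
  qed
  have W: "W2_squared \<sigma> (empirical_measure N \<beta>) \<le> ennreal (\<Sum>i\<in>?I. V i)"
    unfolding V_def A_def by (rule W2_squared_cells_le [OF P \<Omega>b \<Omega>(2) inj T \<mu> cover])
  \<comment> \<open>In the degenerate case \<open>\<Omega>\<close> is a point, which is then the barycenter of every cell.\<close>
  have "(\<Sum>i\<in>?I. V i) \<le> 2 * measure lborel \<Omega> * (sqrt \<epsilon> / real N)"
  proof (cases "measure lborel \<Omega> = 0")
    case True
    have "\<Omega> \<noteq> {}" using em\<Omega> by (metis emeasure_empty zero_neq_one)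
    then obtain p where p: "\<Omega> = {p}"
      by (rule null_interval_singleton [OF \<Omega> \<Omega>b True])
    have "V i = 0" if i: "i \<in> ?I" for i
    proof -
      have "(LINT z|\<sigma>. indicator (A i) z * z) = (LINT z|\<sigma>. p * indicator (A i) z)"
        by (intro Bochner_Integration.integral_cong) (auto simp: A_def p indicator_def)
      then have "\<beta> i = p" using \<beta> [OF i] mA [OF i] N by (simp add: sp)
      then have "V i = (LINT z|\<sigma>. 0)"
        unfolding V_def by (intro Bochner_Integration.integral_cong) (auto simp: A_def p indicator_def)
      then show ?thesis by simp
    qed
    then show ?thesis by (simp add: True)
  next
    case False
    then have pos: "0 < measure lborel \<Omega>" by (simp add: zero_less_measure_iff)
    have "AE y in ?\<mu>. \<bar>y\<bar> \<le> K" using cover\<mu> by eventually_elim (rule K)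
    moreover have "sets ?\<mu> = sets borel" by (simp add: empirical_measure_def)
    ultimately obtain \<rho> where "\<rho> \<in> prob_measures_on \<Omega>" "regularized_functional \<Omega> \<epsilon> ?\<mu> \<rho> < \<infinity>"
      using finite_regularized_functional_exists [OF \<Omega>b \<Omega>(2) pos prob_space_empirical_measure [OF N]] by blast
    then have "regularized_functional \<Omega> \<epsilon> ?\<mu> \<sigma> < \<infinity>" using min by (meson order.strict_trans1)
    then have fin: "boltzmann_entropy \<Omega> \<sigma> < \<infinity>"
      using \<epsilon> unfolding regularized_functional_def
      by (cases "boltzmann_entropy \<Omega> \<sigma>") (auto simp: plus_ereal.simps)
    then have ac: "absolutely_continuous lborel \<sigma>" by (auto simp: boltzmann_entropy_def split: if_splits)
    have atomless: "measure \<sigma> {z} = 0" for z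
    proof -
      have "{z} \<in> null_sets lborel" by (rule finite_imp_null_set_lborel) simp
      with ac have "{z} \<in> null_sets \<sigma>" by (auto simp: absolutely_continuous_def)
      then show ?thesis by (rule measure_eq_0_null_sets)
    qed
    obtain K' where K': "\<And>z. z \<in> \<Omega> \<Longrightarrow> \<bar>z\<bar> \<le> K'" using \<Omega>(2) by (auto simp: bounded_iff)
    have int: "integrable \<sigma> (\<lambda>z. (z - T z)\<^sup>2)"
    proof (rule integrable_const_bound [where B = "(K' + K)\<^sup>2"])
      show "AE z in \<sigma>. norm ((z - T z)\<^sup>2) \<le> (K' + K)\<^sup>2"
        using AE\<Omega> cover
      proof eventually_elim
        case (elim z)
        then have "\<bar>z - T z\<bar> \<le> \<bar>K' + K\<bar>" using K [of "T z"] K' [of z] by linarith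
        then show ?case unfolding abs_le_square_iff by simp
      qed
    qed measurable
    have posA: "0 < measure \<sigma> {z \<in> \<Omega>. T z = x i}" if "i \<in> ?I" for i
      using mA [OF that] N by (simp add: A_def)
    obtain a b where sub: "\<And>i. i \<in> ?I \<Longrightarrow> {a i<..<b i} \<subseteq> \<Omega>"
      and disj: "disjoint_family_on (\<lambda>i. {a i<..<b i}) ?I"
      and cells: "AE z in \<sigma>. \<forall>i\<in>?I. z \<in> {a i<..<b i} \<longleftrightarrow> z \<in> \<Omega> \<and> T z = x i"
      using optimal_cells_are_intervals [OF P \<Omega> \<Omega>b atomless opt int _ inj posA cover] by auto
    have cell: "AE z in \<sigma>. z \<in> {a i<..<b i} \<longleftrightarrow> z \<in> A i" if "i \<in> ?I" for i
      using cells that by (auto elim!: eventually_mono simp: A_def)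
    have mJ: "measure \<sigma> {a i<..<b i} = 1 / N" if i: "i \<in> ?I" for i
      using measure_eq_AE [OF cell [OF i]] mA [OF i] by (simp add: s)
    have intJ: "(LINT z|\<sigma>. indicator (A i) z * g z) = (LINT z|\<sigma>. indicator {a i<..<b i} z * g z)"
      if "i \<in> ?I" and [measurable]: "g \<in> borel_measurable borel" for i and g :: "real \<Rightarrow> real"
      using cell [OF that(1)] by (intro integral_cong_AE) (auto elim!: eventually_mono simp: indicator_def)
    have V: "V i \<le> 2 * sqrt \<epsilon> * (1 / N) * (b i - a i)" if i: "i \<in> ?I" for i
    proof -
      have "V i = (LINT z|\<sigma>. indicator {a i<..<b i} z * (z - \<beta> i)\<^sup>2)"
        unfolding V_def using i by (intro intJ) auto
      also have "\<dots> \<le> 2 * sqrt \<epsilon> * (1 / N) * (b i - a i)"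
      proof (rule cell_variance_le [OF \<Omega>b \<Omega>(2) \<epsilon> P min fin opt int sub [OF i]])
        show "AE z in \<sigma>. z \<in> {a i<..<b i} \<longrightarrow> T z = x i"
          using cell [OF i] by eventually_elim (auto simp: A_def)
        show "\<beta> i = (LINT z|\<sigma>. indicator {a i<..<b i} z * z) / (1 / N)"
          using \<beta> [OF i] intJ [OF i, of "\<lambda>z. z"] by simp
      qed (use mJ [OF i] N in auto)
      finally show ?thesis .
    qed
    have "a i \<le> b i" if i: "i \<in> ?I" for i
    proof (rule ccontr)
      assume "\<not> a i \<le> b i" with mJ [OF i] N show False by simp
    qed
    then have len: "(\<Sum>i\<in>?I. b i - a i) \<le> measure lborel \<Omega>"
      using sum_disjoint_interval_lengths_le [OF _ _ sub disj \<Omega>(2) \<Omega>b] by simp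
    have "(\<Sum>i\<in>?I. V i) \<le> (\<Sum>i\<in>?I. 2 * sqrt \<epsilon> * (1 / N) * (b i - a i))" using V by (rule sum_mono)
    also have "\<dots> = 2 * sqrt \<epsilon> * (1 / N) * (\<Sum>i\<in>?I. b i - a i)" by (rule sum_distrib_left [symmetric])
    also have "\<dots> \<le> 2 * sqrt \<epsilon> * (1 / N) * measure lborel \<Omega>"
      using len \<epsilon> by (intro mult_left_mono) auto
    finally show ?thesis by (simp add: field_simps)
  qed
  with W show "W2_squared \<sigma> (empirical_measure N \<beta>) \<le> ennreal (2 * measure lborel \<Omega> * (sqrt \<epsilon> / real N))"
    by (meson ennreal_leI order_trans)
qed

end
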